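(* Let $\mathbf{n}_\kappa$ and $\mathbf{m}_\kappa=(m_\kappa(i))_{i\ge0}$, $\kappa\ge 1$, be degree statistics such that $|\mathbf{n}_\kappa|\to\infty$ as $\kappa\to\infty$ and, for every $i\ge 0$, $p_i(\mathbf{n}_\kappa)\to p_i$ as $\kappa\to\infty$, where $\mathbf{p}=(p_i)_{i\ge 0}$ is a probability distribution on $\mathbb{N}_0$, and such that as $\kappa\to\infty$, $$|\mathbf{m}_\kappa|^2\,\pi_{\mathbf{p}(\mathbf{n}_\kappa)}(\mathbb{T}_{\mathbf{m}_\kappa})\sum_{i\in\mathcal{D}(\mathbf{m}_\kappa)}\frac{p_i(\mathbf{m}_\kappa)^2}{p_i(\mathbf{n}_\kappa)}=o(1).$$ Then, as $\kappa\to\infty$: (i) If $|\mathbf{n}_\kappa|\,\pi_{\mathbf{p}(\mathbf{n}_\kappa)}(\mathbb{T}_{\mathbf{m}_\kappa})\to\lambda$ for some $\lambda\in(0,\infty)$, then $N_{\mathbf{m}_\kappa}(\mathcal{T}_{\mathbf{n}_\kappa})$ converges in distribution to $\mathrm{Po}(\lambda)$, with convergence of all moments. (ii) If $|\mathbf{n}_\kappa|\,\pi_{\mathbf{p}(\mathbf{n}_\kappa)}(\mathbb{T}_{\mathbf{m}_\kappa})\to\infty$, then $$\frac{N_{\mathbf{m}_\kappa}(\mathcal{T}_{\mathbf{n}_\kappa})-|\mathbf{n}_\kappa|\,\pi_{\mathbf{p}(\mathbf{n}_\kappa)}(\mathbb{T}_{\mathbf{m}_\kappa})}{\sqrt{|\mathbf{n}_\kappa|\,\pi_{\mathbf{p}(\mathbf{n}_\kappa)}(\mathbb{T}_{\mathbf{m}_\kappa})}}$$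 converges in distribution to $\mathrm{N}(0,1)$, with convergence of mean and variance (to $0$ and $1$, respectively). Thus, in both cases, $$\mathbb{E}\bigl[N_{\mathbf{m}_\kappa}(\mathcal{T}_{\mathbf{n}_\kappa})\bigr]\sim\mathrm{Var}\bigl[N_{\mathbf{m}_\kappa}(\mathcal{T}_{\mathbf{n}_\kappa})\bigr]\sim|\mathbf{n}_\kappa|\,\pi_{\mathbf{p}(\mathbf{n}_\kappa)}(\mathbb{T}_{\mathbf{m}_\kappa}).$$
   Context: $\mathbb{N}_0=\{0,1,2,\dots\}$. All trees are finite rooted plane (ordered) trees (up to isomorphism of plane rooted trees); $d_T(v)$ is the (out)degree, i.e. number of children, of a vertex $v\in T$. The degree statistic of $T$ is $\mathbf{n}_T=(n_T(i))_{i\ge 0}$ with $n_T(i)=\#\{v\in T: d_T(v)=i\}$. A sequence $\mathbf{n}=(n(i))_{i\ge 0}$ of nonnegative integers is called a degree statistic if $\sum_{i\ge 0}n(i)=1+\sum_{i\ge 0}i\,n(i)<\infty$ (equivalently, it is the degree statistic of some tree). Put $|\mathbf{n}|=\sum_i n(i)$, $\mathcal{D}(\mathbf{n})=\{i: n(i)>0\}$, and $\mathbf{p}(\mathbf{n})=(p_i(\mathbf{n}))_{i\ge 0}$ with $p_i(\mathbf{n})=n(i)/|\mathbf{n}|$. $\mathbb{T}_{\mathbf{n}}$ is the (finite) set of plane rooted trees with degree statistic $\mathbf{n}$, and $\mathcal{T}_{\mathbf{n}}$ is a uniformly random element of $\mathbb{T}_{\mathbf{n}}$. For $v\in T$, the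 fringe tree $T_v$ is the subtree of $T$ consisting of $v$ and all its descendants, rooted at $v$. For a degree statistic $\mathbf{m}$, $N_{\mathbf{m}}(T)=\#\{v\in T: T_v\in\mathbb{T}_{\mathbf{m}}\}$ is the number of fringe trees of $T$ with degree statistic $\mathbf{m}$. For a probability distribution $\mathbf{p}=(p_i)_{i\ge0}$ on $\mathbb{N}_0$ and a tree $T$, $\pi_{\mathbf{p}}(T)=\prod_{i\ge 0}p_i^{n_T(i)}$ (with $0^0=1$), and $\pi_{\mathbf{p}}(\mathbb{T}_{\mathbf{m}})=\sum_{T\in\mathbb{T}_{\mathbf{m}}}\pi_{\mathbf{p}}(T)=|\mathbb{T}_{\mathbf{m}}|\prod_{i\ge 0}p_i^{m(i)}$. $\mathrm{Po}(\lambda)$ is the Poisson distribution with mean $\lambda$; $\mathrm{N}(0,1)$ is the standard normal distribution. "Convergence of all moments" means that for every $r\in\mathbb{N}$ the $r$-th moment converges to the $r$-th moment of the limit. $a_\kappa\sim b_\kappa$ means $a_\kappa/b_\kappa\to 1$. *)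

theory Defs
  imports "HOL-Probability.Probability" "HOL-Library.Landau_Symbols"
begin

text \<open>Plane rooted trees up to isomorphism. Vertices are addressed by Ulam-Harris words:
  the root is \<open>[]\<close> and \<open>i # v\<close> is the vertex \<open>v\<close> of the subtree at the \<open>i\<close>-th child of the root.\<close>

datatype ptree = Node (children: "ptree list")

primrec is_vertex :: "nat list \<Rightarrow> ptree \<Rightarrow> bool" where
  "is_vertex [] T \<longleftrightarrow> True"
| "is_vertex (i # v) T \<longleftrightarrow> i < length (children T) \<and> is_vertex v (children T ! i)"

primrec fringe_tree :: "nat list \<Rightarrow> ptree \<Rightarrow> ptree" where
  "fringe_tree [] T = T"
| "fringe_tree (i # v) T = fringe_tree v (children T ! i)"

definition vertices :: "ptree \<Rightarrow> nat list set" where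
  "vertices T = {v. is_vertex v T}"

definition outdegree :: "ptree \<Rightarrow> nat list \<Rightarrow> nat" where
  "outdegree T v = length (children (fringe_tree v T))"

definition degree_stat :: "ptree \<Rightarrow> nat \<Rightarrow> nat" where
  "degree_stat T i = card {v \<in> vertices T. outdegree T v = i}"

definition degrees :: "(nat \<Rightarrow> nat) \<Rightarrow> nat set" where
  "degrees n = {i. n i > 0}"

text \<open>For sequences of natural numbers, finiteness of the sums amounts to finite support;
  all sums and products below are therefore taken over the support.\<close>

definition is_degree_statistic :: "(nat \<Rightarrow> nat) \<Rightarrow> bool" where
  "is_degree_statistic n \<longleftrightarrow>
     finite (degrees n) \<and> (\<Sum>i\<in>degrees n. n i) = 1 + (\<Sum>i\<in>degrees n. i * n i)"

definition stat_size :: "(nat \<Rightarrow> nat) \<Rightarrow> nat" where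
  "stat_size n = (\<Sum>i\<in>degrees n. n i)"

definition stat_prob :: "(nat \<Rightarrow> nat) \<Rightarrow> nat \<Rightarrow> real" where
  "stat_prob n i = real (n i) / real (stat_size n)"

definition trees :: "(nat \<Rightarrow> nat) \<Rightarrow> ptree set" where
  "trees n = {T. degree_stat T = n}"

definition random_tree :: "(nat \<Rightarrow> nat) \<Rightarrow> ptree pmf" where
  "random_tree n = pmf_of_set (trees n)"

definition fringe_count :: "(nat \<Rightarrow> nat) \<Rightarrow> ptree \<Rightarrow> nat" where
  "fringe_count m T = card {v \<in> vertices T. fringe_tree v T \<in> trees m}"

definition tree_weight :: "(nat \<Rightarrow> real) \<Rightarrow> ptree \<Rightarrow> real" where
  "tree_weight p T = (\<Prod>i\<in>degrees (degree_stat T). p i ^ degree_stat T i)"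

definition trees_weight :: "(nat \<Rightarrow> real) \<Rightarrow> (nat \<Rightarrow> nat) \<Rightarrow> real" where
  "trees_weight p m = (\<Sum>T\<in>trees m. tree_weight p T)"

text \<open>Finiteness of the sets whose cardinalities, sums or uniform distributions are used above.\<close>

lemma vertices_Node:
  "vertices (Node ts) = insert [] (\<Union>i<length ts. Cons i ` vertices (ts ! i))"
proof (rule set_eqI)
  fix v show "v \<in> vertices (Node ts) \<longleftrightarrow> v \<in> insert [] (\<Union>i<length ts. Cons i ` vertices (ts ! i))"
    by (cases v) (auto simp: vertices_def)
qed

lemma finite_vertices: "finite (vertices T)"
  by (induction T) (auto simp: vertices_Node)

lemma finite_card_vertices_le: "finite {T. card (vertices T) \<le> k}"
proof (induction k)
  case 0
  have "vertices T \<noteq> {}" for T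
    by (auto simp: vertices_def intro: exI[of _ "[]"])
  then show ?case by (simp add: finite_vertices)
next
  case (Suc k)
  let ?A = "{T. card (vertices T) \<le> k}"
  have "{T. card (vertices T) \<le> Suc k} \<subseteq> Node ` {ts. set ts \<subseteq> ?A \<and> length ts \<le> k}"
  proof
    fix T assume "T \<in> {T. card (vertices T) \<le> Suc k}"
    then obtain ts where T: "T = Node ts" and le: "card (vertices (Node ts)) \<le> Suc k"
      by (cases T) auto
    let ?B = "\<Union>i<length ts. Cons i ` vertices (ts ! i)"
    have fin: "finite ?B" by (auto simp: finite_vertices)
    have B: "card ?B \<le> k"
      using le fin by (simp add: vertices_Node card_insert_if image_iff split: if_splits)
    have "(\<lambda>i. [i]) ` {..<length ts} \<subseteq> ?B" by (auto simp: vertices_def)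
    from card_mono[OF fin this] have "length ts \<le> card ?B"
      by (simp add: card_image inj_on_def)
    moreover have "ts ! i \<in> ?A" if "i < length ts" for i
    proof -
      have "Cons i ` vertices (ts ! i) \<subseteq> ?B" using that by auto
      from card_mono[OF fin this] B show ?thesis by (simp add: card_image)
    qed
    ultimately show "T \<in> Node ` {ts. set ts \<subseteq> ?A \<and> length ts \<le> k}"
      using B unfolding T by (intro imageI) (fastforce simp: in_set_conv_nth)
  qed
  with finite_lists_length_le[OF Suc, of k] show ?case
    by (meson finite_imageI finite_subset)
qed

lemma stat_size_degree_stat: "stat_size (degree_stat T) = card (vertices T)"
proof -
  have "degrees (degree_stat T) = outdegree T ` vertices T"
    using finite_vertices[of T] by (auto simp: degrees_def degree_stat_def card_gt_0_iff)
  then have "stat_size (degree_stat T)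
      = (\<Sum>i\<in>outdegree T ` vertices T. card {v \<in> vertices T. outdegree T v = i})"
    by (simp add: stat_size_def degree_stat_def)
  also have "\<dots> = card (vertices T)"
    using sum.image_gen[OF finite_vertices[of T], of "\<lambda>_. 1::nat" "outdegree T"] by simp
  finally show ?thesis .
qed

lemma finite_trees: "finite (trees n)"
proof (rule finite_subset[OF _ finite_card_vertices_le[of "stat_size n"]])
  show "trees n \<subseteq> {T. card (vertices T) \<le> stat_size n}"
    by (auto simp: trees_def simp flip: stat_size_degree_stat)
qed

end

theory Submission
  imports Defs "HOL-Complex_Analysis.Conformal_Mappings"
begin

text \<open>Write \<open>N = |n|\<close>, \<open>M = |m|\<close>, \<open>\<tau>\<close> for the number of trees with statistic \<open>m\<close>, and \<open>(x)\<^sub>q\<close> for the falling factorial. Two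
different fringe trees with the same statistic \<open>m\<close> have the same size and are therefore disjoint.
Contracting \<open>q\<close> of them to marked leaves turns the count of trees with \<open>q\<close> marked fringe trees into a
count of trees with a smaller statistic, and the factorial moments of the fringe count come out in
closed form (\<open>expectation_falling_fringe_count\<close>):
\<open>\<tau> ^ q (\<Prod>i. (n i)\<^sub>q\<^sub>m\<^sub>i) / (N - 1)\<^sub>q\<^sub>(\<^sub>M\<^sub>-\<^sub>1\<^sub>)\<close>.

If all falling factorials were powers, this would be \<open>\<mu> ^ q\<close> with \<open>\<mu> = N \<pi>(trees m)\<close>. The relative error is at
most of the order \<open>q\<^sup>2 S\<close> with \<open>S = \<Sum>i. (m i)\<^sup>2 / n i\<close> (\<open>expectation_falling_ratio_bounds\<close>), and the hypothesis
of the theorem says precisely that \<open>\<mu> S\<close> tends to \<open>0\<close>. Hence the factorial moment of order \<open>q\<close> is asymptotic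
to \<open>\<mu> ^ q\<close> uniformly for \<open>q\<close> up to any constant multiple of \<open>sqrt \<mu>\<close>. Everything else follows from this
statement about sequences of laws on the natural numbers.

For \<open>q = 1\<close> and \<open>q = 2\<close> the error is \<open>o(1 / \<mu>)\<close> and gives the mean and the variance. If \<open>\<mu>\<close> tends to a finite limit
\<open>\<lambda>\<close>, all factorial moments converge to those of the Poisson law, which determines the moments and, through
a truncated expansion of the characteristic function, the limit law (\<open>poisson_limit\<close>).

If \<open>\<mu>\<close> tends to infinity, take \<open>q = \<lfloor>c sqrt \<mu>\<rfloor>\<close> as Gao and Wormald do. For \<open>x = \<mu> + z sqrt \<mu>\<close> the normalized falling
factorial \<open>(x)\<^sub>q / \<mu> ^ q\<close> is close to \<open>exp (c z - c\<^sup>2 / 2)\<close>, and its mean tends to \<open>1\<close>. So every limit law of the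
standardized fringe count has the mean \<open>exp (c\<^sup>2 / 2)\<close> of \<open>exp (c z)\<close> for all \<open>c > 0\<close> (\<open>limit_law_mgf\<close>), and analytic
continuation to the right half plane up to the imaginary axis identifies it as the standard normal law
(\<open>std_normal_if_mgf_right\<close>).\<close>

section \<open>Plane forests\<close>

text \<open>The degree statistic, the fringe count and the number of vertices all count vertices by a property
of the fringe tree there. Treating them together yields one recursion at the root for all three.\<close>
definition vertex_count :: "(ptree \<Rightarrow> bool) \<Rightarrow> ptree \<Rightarrow> nat" where
  "vertex_count P T = card {v \<in> vertices T. P (fringe_tree v T)}"

lemma vertex_count_Node:
  "vertex_count P (Node ts) = of_bool (P (Node ts)) + (\<Sum>t\<leftarrow>ts. vertex_count P t)"
proof -
  define V where "V i = Cons i ` {v \<in> vertices (ts ! i). P (fringe_tree v (ts ! i))}" for i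
  have eq: "{v \<in> vertices (Node ts). P (fringe_tree v (Node ts))}
      = {v. v = [] \<and> P (Node ts)} \<union> (\<Union>i<length ts. V i)"
    by (auto simp: vertices_Node V_def)
  have fin: "finite (V i)" for i
    by (simp add: V_def finite_vertices)
  have "card (\<Union>i<length ts. V i) = (\<Sum>i<length ts. card (V i))"
    using fin by (intro card_UN_disjoint) (auto simp: V_def)
  also have "\<dots> = (\<Sum>i<length ts. vertex_count P (ts ! i))"
    by (simp add: V_def vertex_count_def card_image)
  also have "\<dots> = (\<Sum>t\<leftarrow>ts. vertex_count P t)"
    by (simp add: sum_list_sum_nth atLeast0LessThan)
  finally have "card (\<Union>i<length ts. V i) = (\<Sum>t\<leftarrow>ts. vertex_count P t)" .
  moreover have "card {v::nat list. v = [] \<and> P (Node ts)} = of_bool (P (Node ts))"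
    by (cases "P (Node ts)") auto
  moreover have "{v. v = [] \<and> P (Node ts)} \<inter> (\<Union>i<length ts. V i) = {}"
    by (auto simp: V_def)
  ultimately show ?thesis
    unfolding vertex_count_def eq by (subst card_Un_disjoint) (auto simp: fin)
qed

lemma degree_stat_eq_vertex_count: "degree_stat T i = vertex_count (\<lambda>t. length (children t) = i) T"
  by (simp add: degree_stat_def vertex_count_def outdegree_def)

lemma fringe_count_eq_vertex_count: "fringe_count m T = vertex_count (\<lambda>t. t \<in> trees m) T"
  by (simp add: fringe_count_def vertex_count_def)

lemma card_vertices_eq_vertex_count: "card (vertices T) = vertex_count (\<lambda>_. True) T"
  by (simp add: vertex_count_def)

definition forest_stat :: "ptree list \<Rightarrow> nat \<Rightarrow> nat" where
  "forest_stat ts i = (\<Sum>t\<leftarrow>ts. degree_stat t i)"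

definition forest_fringe_count :: "(nat \<Rightarrow> nat) \<Rightarrow> ptree list \<Rightarrow> nat" where
  "forest_fringe_count m ts = (\<Sum>t\<leftarrow>ts. fringe_count m t)"

definition forests :: "nat \<Rightarrow> (nat \<Rightarrow> nat) \<Rightarrow> ptree list set" where
  "forests k n = {ts. length ts = k \<and> forest_stat ts = n}"

lemma degree_stat_Node:
  "degree_stat (Node ts) i = of_bool (i = length ts) + forest_stat ts i"
  by (auto simp: degree_stat_eq_vertex_count vertex_count_Node forest_stat_def)

lemma fringe_count_Node:
  "fringe_count m (Node ts) = of_bool (Node ts \<in> trees m) + forest_fringe_count m ts"
  by (simp add: fringe_count_eq_vertex_count vertex_count_Node forest_fringe_count_def)

lemma card_vertices_Node:
  "card (vertices (Node ts)) = 1 + (\<Sum>t\<leftarrow>ts. card (vertices t))"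
  by (simp add: card_vertices_eq_vertex_count vertex_count_Node)

lemma forest_stat_simps [simp]:
  "forest_stat [] i = 0" "forest_stat (t # ts) i = degree_stat t i + forest_stat ts i"
  "forest_stat (ts @ us) i = forest_stat ts i + forest_stat us i"
  by (simp_all add: forest_stat_def)

lemma forest_fringe_count_simps [simp]:
  "forest_fringe_count m [] = 0"
  "forest_fringe_count m (t # ts) = fringe_count m t + forest_fringe_count m ts"
  "forest_fringe_count m (ts @ us) = forest_fringe_count m ts + forest_fringe_count m us"
  by (simp_all add: forest_fringe_count_def)

lemma finite_degrees_degree_stat: "finite (degrees (degree_stat T))"
proof -
  have "degrees (degree_stat T) \<subseteq> outdegree T ` vertices T"
    by (auto simp: degrees_def degree_stat_def card_gt_0_iff)
  then show ?thesis
    by (rule finite_subset) (simp add: finite_vertices)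
qed

lemma finite_degrees_forest_stat: "finite (degrees (forest_stat ts))"
proof (induction ts)
  case (Cons t ts)
  have "degrees (forest_stat (t # ts)) \<subseteq> degrees (degree_stat t) \<union> degrees (forest_stat ts)"
    by (auto simp: degrees_def)
  then show ?case
    using Cons finite_degrees_degree_stat[of t] by (meson finite_UnI finite_subset)
qed (simp add: degrees_def)

lemma stat_size_eq_sum:
  assumes "finite D" "degrees n \<subseteq> D"
  shows "stat_size n = sum n D"
  unfolding stat_size_def using assms by (intro sum.mono_neutral_left) (auto simp: degrees_def)

lemma is_degree_statistic_sum:
  assumes "is_degree_statistic n" "finite D" "degrees n \<subseteq> D"
  shows "sum n D = 1 + (\<Sum>i\<in>D. i * n i)"
proof -
  have "(\<Sum>i\<in>degrees n. i * n i) = (\<Sum>i\<in>D. i * n i)" "sum n (degrees n) = sum n D"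
    using assms(2,3) by (intro sum.mono_neutral_left; auto simp: degrees_def)+
  with assms(1) show ?thesis
    by (simp add: is_degree_statistic_def)
qed

lemma stat_size_forest_stat:
  "stat_size (forest_stat ts) = (\<Sum>t\<leftarrow>ts. card (vertices t))"
proof (induction ts)
  case (Cons t ts)
  let ?D = "degrees (degree_stat t) \<union> degrees (forest_stat ts)"
  have fin: "finite ?D"
    by (simp add: finite_degrees_degree_stat finite_degrees_forest_stat)
  have "stat_size (forest_stat (t # ts)) = (\<Sum>i\<in>?D. degree_stat t i + forest_stat ts i)"
    by (subst stat_size_eq_sum[OF fin]) (auto simp: degrees_def)
  also have "\<dots> = stat_size (degree_stat t) + stat_size (forest_stat ts)"
    by (simp add: sum.distrib stat_size_eq_sum[OF fin])
  finally show ?case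
    by (simp only: Cons.IH stat_size_degree_stat list.map sum_list.Cons)
qed (simp add: stat_size_def degrees_def)

lemma finite_forests: "finite (forests k n)"
proof (rule finite_subset)
  show "forests k n \<subseteq> {ts. set ts \<subseteq> {T. card (vertices T) \<le> stat_size n} \<and> length ts = k}"
  proof
    fix ts assume ts: "ts \<in> forests k n"
    then have "(\<Sum>t\<leftarrow>ts. card (vertices t)) = stat_size n"
      by (auto simp: forests_def simp flip: stat_size_forest_stat)
    then have "card (vertices t) \<le> stat_size n" if "t \<in> set ts" for t
      using that member_le_sum_list[of "card (vertices t)" "map (\<lambda>t. card (vertices t)) ts"] by auto
    with ts show "ts \<in> {ts. set ts \<subseteq> {T. card (vertices T) \<le> stat_size n} \<and> length ts = k}"
      by (auto simp: forests_def)
  qed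
  show "finite {ts. set ts \<subseteq> {T. card (vertices T) \<le> stat_size n} \<and> length ts = k}"
    by (rule finite_lists_length_eq[OF finite_card_vertices_le])
qed

lemma forests_0: "forests 0 n = (if n = (\<lambda>_. 0) then {[]} else {})"
  by (auto simp: forests_def fun_eq_iff)

lemma card_vertices_of_trees: "T \<in> trees m \<Longrightarrow> card (vertices T) = stat_size m"
  by (auto simp: trees_def simp flip: stat_size_degree_stat)

text \<open>A fringe tree is no larger than the tree that contains it. Hence a tree with degree statistic \<open>m\<close> has
no further fringe tree of that kind strictly below its root, and two such fringe trees of one tree
are either equal or disjoint.\<close>
lemma fringe_count_eq_0_if_small: "card (vertices T) < stat_size m \<Longrightarrow> fringe_count m T = 0"
proof (induction T)
  case (Node ts)
  have "Node ts \<notin> trees m"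
    using Node.prems card_vertices_of_trees by fastforce
  moreover have "fringe_count m t = 0" if "t \<in> set ts" for t
  proof (rule Node.IH[OF that])
    have "card (vertices t) \<le> (\<Sum>t\<leftarrow>ts. card (vertices t))"
      using that by (intro member_le_sum_list) auto
    with Node.prems show "card (vertices t) < stat_size m"
      by (simp add: card_vertices_Node)
  qed
  ultimately show ?case
    by (simp add: fringe_count_Node forest_fringe_count_def)
qed

lemma forest_fringe_count_children_eq_0:
  assumes "Node ts \<in> trees m"
  shows "forest_fringe_count m ts = 0"
proof -
  have "fringe_count m t = 0" if "t \<in> set ts" for t
  proof (rule fringe_count_eq_0_if_small)
    have "card (vertices t) \<le> (\<Sum>t\<leftarrow>ts. card (vertices t))"
      using that by (intro member_le_sum_list) auto
    with card_vertices_of_trees[OF assms] show "card (vertices t) < stat_size m"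
      by (simp add: card_vertices_Node)
  qed
  then show ?thesis
    by (simp add: forest_fringe_count_def)
qed

text \<open>Removing the root of the first tree and putting the trees below it in front of the others loses only
the degree \<open>i\<close> of that root. The fringe trees at all other vertices remain the same, which is why this
step can be iterated while counting them. The counts are on forests because a tree turns into a forest.\<close>
lemma bij_betw_forests_remove_root:
  "bij_betw (\<lambda>(i, us). Node (take i us) # drop i us)
     (SIGMA i:degrees n. forests (k + i) (n(i := n i - 1))) (forests (Suc k) n)"
proof (rule bij_betw_byWitness[where f' = "\<lambda>F. (length (children (hd F)), children (hd F) @ tl F)"])
  have stat: "forest_stat (Node (take i us) # drop i us) = n"
    if "i \<in> degrees n" "us \<in> forests (k + i) (n(i := n i - 1))" for i us
  proof
    fix j
    have "forest_stat (take i us) j + forest_stat (drop i us) j = forest_stat us j"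
      by (metis append_take_drop_id forest_stat_simps(3))
    then show "forest_stat (Node (take i us) # drop i us) j = n j"
      using that by (auto simp: degree_stat_Node forests_def degrees_def)
  qed
  show "(\<lambda>(i, us). Node (take i us) # drop i us) ` (SIGMA i:degrees n. forests (k + i) (n(i := n i - 1)))
      \<subseteq> forests (Suc k) n"
    using stat by (auto simp: forests_def)
  show "(\<lambda>F. (length (children (hd F)), children (hd F) @ tl F)) ` forests (Suc k) n
      \<subseteq> (SIGMA i:degrees n. forests (k + i) (n(i := n i - 1)))"
  proof
    fix x assume "x \<in> (\<lambda>F. (length (children (hd F)), children (hd F) @ tl F)) ` forests (Suc k) n"
    then obtain F where F: "F \<in> forests (Suc k) n"
      and x: "x = (length (children (hd F)), children (hd F) @ tl F)" by blast
    from F have "length F = Suc k" by (simp add: forests_def)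
    then obtain t us where "F = t # us" by (cases F) auto
    moreover obtain ts where "t = Node ts" by (cases t)
    ultimately have Feq: "F = Node ts # us" by simp
    have "n j = of_bool (j = length ts) + forest_stat ts j + forest_stat us j" for j
      using F by (auto simp: forests_def Feq degree_stat_Node)
    then show "x \<in> (SIGMA i:degrees n. forests (k + i) (n(i := n i - 1)))"
      using F by (auto simp: x Feq forests_def degrees_def fun_eq_iff)
  qed
qed (auto simp: forests_def length_Suc_conv)

section \<open>Forests with marked fringe trees\<close>

text \<open>The number of forests in which \<open>q\<close> of the vertices whose fringe tree has degree statistic \<open>m\<close> are marked.\<close>
definition marked_forests :: "(nat \<Rightarrow> nat) \<Rightarrow> nat \<Rightarrow> nat \<Rightarrow> (nat \<Rightarrow> nat) \<Rightarrow> nat" where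
  "marked_forests m q k n = (\<Sum>F\<in>forests k n. forest_fringe_count m F choose q)"

lemma sum_forests_remove_root:
  assumes "finite (degrees n)"
  shows "(\<Sum>F\<in>forests (Suc k) n. \<phi> F) =
    (\<Sum>i\<in>degrees n. \<Sum>us\<in>forests (k + i) (n(i := n i - 1)). \<phi> (Node (take i us) # drop i us))"
  by (subst sum.reindex_bij_betw[OF bij_betw_forests_remove_root, symmetric],
      subst sum.Sigma) (auto simp: assms finite_forests intro!: sum.cong)

lemma forests_first_in_trees:
  "{F \<in> forests (Suc k) n. hd F \<in> trees m} =
     (if \<forall>i. m i \<le> n i then (\<lambda>(t, F). t # F) ` (trees m \<times> forests k (\<lambda>i. n i - m i)) else {})"
proof -
  have "m i \<le> n i" if "F \<in> forests (Suc k) n" "hd F \<in> trees m" for F i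
    using that by (auto simp: forests_def trees_def length_Suc_conv)
  moreover have "F \<in> forests (Suc k) n \<and> hd F \<in> trees m \<longleftrightarrow>
      F \<in> (\<lambda>(t, F). t # F) ` (trees m \<times> forests k (\<lambda>i. n i - m i))"
    if "\<forall>i. m i \<le> n i" for F
  proof (cases F)
    case (Cons t us)
    have "(\<forall>i. m i + forest_stat us i = n i) \<longleftrightarrow> (\<forall>i. forest_stat us i = n i - m i)"
    proof -
      have "m i + forest_stat us i = n i \<longleftrightarrow> forest_stat us i = n i - m i" for i
        using that[rule_format, of i] by linarith
      then show ?thesis by simp
    qed
    then show ?thesis
      by (auto simp: Cons forests_def trees_def fun_eq_iff image_iff)
  qed (auto simp: forests_def)
  ultimately show ?thesis
    by auto
qed

lemma marked_forests_0: 
  "marked_forests m q 0 n = (if n = (\<lambda>_. 0) \<and> q = 0 then 1 else 0)"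
  by (auto simp: marked_forests_def forests_0)

text \<open>If the root of the first tree is unmarked, remove it. If it is marked, the first tree has statistic
\<open>m\<close> and carries no other mark, so it can be any element of \<open>trees m\<close> and the other \<open>q - 1\<close> marks sit
in the remaining \<open>k\<close> trees.\<close>
lemma marked_forests_Suc:
  assumes fin: "finite (degrees n)"
  shows "marked_forests m q (Suc k) n =
    (\<Sum>i\<in>degrees n. marked_forests m q (k + i) (n(i := n i - 1))) +
    (if q > 0 \<and> (\<forall>i. m i \<le> n i) then card (trees m) * marked_forests m (q - 1) k (\<lambda>i. n i - m i) else 0)"
proof -
  \<comment> \<open>\<open>f\<close> counts the choices of marks that contain the first root, \<open>g\<close> those that avoid it.\<close>
  define f where "f F = (if hd F \<in> trees m \<and> q > 0 then forest_fringe_count m (tl F) choose (q - 1) else 0)" for F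
  define g where "g F = (forest_fringe_count m (children (hd F) @ tl F) choose q)" for F
  have split: "forest_fringe_count m F choose q = g F + f F" if "F \<in> forests (Suc k) n" for F
  proof -
    obtain ts us where F: "F = Node ts # us"
      using \<open>F \<in> forests (Suc k) n\<close> by (auto simp: forests_def length_Suc_conv) (metis ptree.exhaust)
    show ?thesis
    proof (cases "Node ts \<in> trees m")
      case True
      with forest_fringe_count_children_eq_0[OF True] show ?thesis
        by (cases q) (auto simp: F g_def f_def fringe_count_Node)
    qed (simp add: F g_def f_def fringe_count_Node)
  qed
  have "(\<Sum>F\<in>forests (Suc k) n. g F) = (\<Sum>i\<in>degrees n. marked_forests m q (k + i) (n(i := n i - 1)))"
    by (subst sum_forests_remove_root[OF fin])
      (simp add: g_def marked_forests_def flip: forest_fringe_count_simps(3))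
  moreover have "(\<Sum>F\<in>forests (Suc k) n. f F) =
    (if q > 0 \<and> (\<forall>i. m i \<le> n i) then card (trees m) * marked_forests m (q - 1) k (\<lambda>i. n i - m i) else 0)"
  proof (cases "q > 0")
    case True
    have "(\<Sum>F\<in>forests (Suc k) n. f F) =
        (\<Sum>F\<in>{F\<in>forests (Suc k) n. hd F \<in> trees m}. forest_fringe_count m (tl F) choose (q - 1))"
      using True by (intro sum.mono_neutral_cong_right) (auto simp: finite_forests f_def)
    also have "\<dots> = (if \<forall>i. m i \<le> n i then
        (\<Sum>(t, F)\<in>trees m \<times> forests k (\<lambda>i. n i - m i). forest_fringe_count m F choose (q - 1)) else 0)"
      unfolding forests_first_in_trees
      by (auto simp: sum.reindex inj_on_def case_prod_beta intro!: sum.cong)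
    finally show ?thesis
      using True by (simp add: marked_forests_def sum.cartesian_product[symmetric])
  qed (simp add: f_def)
  ultimately show ?thesis
    by (simp add: marked_forests_def split sum.distrib)
qed

text \<open>This is \<open>1 / (n - a)!\<close>, where the reciprocal of the factorial of a negative integer is read as \<open>0\<close>.
With this reading the recursion of \<open>marked_forests\<close> needs no distinction between possible and
impossible numbers of marks.\<close>
definition inv_fact_diff :: "nat \<Rightarrow> nat \<Rightarrow> real" where
  "inv_fact_diff n a = (if a \<le> n then 1 / fact (n - a) else 0)"

lemma inv_fact_diff_pred:
  assumes "n > 0"
  shows "inv_fact_diff (n - 1) a = (real n - real a) * inv_fact_diff n a"
proof -
  consider "a < n" | "a = n" | "a > n" by linarith
  then show ?thesis
  proof cases
    case 1
    then have "n - a = Suc (n - 1 - a)" by simp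
    then have "fact (n - a) = (real n - real a) * fact (n - 1 - a)"
      using 1 by (simp add: of_nat_diff)
    with 1 show ?thesis
      by (simp add: inv_fact_diff_def)
  qed (use assms in \<open>auto simp: inv_fact_diff_def\<close>)
qed

text \<open>Contracting every marked fringe tree to a leaf explains the formula: what is left is a forest with
statistic \<open>n - q m + q e\<close>, where \<open>e\<close> counts one leaf, with \<open>q\<close> marked leaves, and the number of forests of
\<open>k\<close> trees with \<open>s\<close> vertices is \<open>k / s\<close> times a multinomial coefficient. The proof is an induction along
the removal of the first root. The quantity \<open>M\<close> below is the number of vertices after the
contraction, and the induction step amounts to
\<open>(\<Sum>i. (k - 1 + i) a i) + q (k - 1) = k (M - 1)\<close> with \<open>a = n - q m\<close>.
The set \<open>D\<close> is any finite set that supports \<open>n\<close> and \<open>m\<close>; it stays the same during the induction.\<close>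
lemma marked_forests_formula:
  assumes D: "finite D" "degrees n \<subseteq> D" "degrees m \<subseteq> D" and m: "is_degree_statistic m"
    and sum_n: "sum n D = k + (\<Sum>i\<in>D. i * n i)"
    and ne: "k > 0 \<or> q > 0 \<or> n \<noteq> (\<lambda>_. 0)"
  shows "fact q * real (marked_forests m q k n) =
    real (card (trees m)) ^ q * real k * fact (sum n D + q - q * stat_size m - 1) *
    (\<Prod>i\<in>D. inv_fact_diff (n i) (q * m i))"
  using D(2) sum_n ne
proof (induction "sum n D" arbitrary: n k q rule: less_induct)
  case less
  note fin = \<open>finite D\<close>
  define P where "P = (\<Prod>i\<in>D. inv_fact_diff (n i) (q * m i))"
  define c where "c = real (card (trees m))"
  define s where "s = sum n D"
  have m_size: "stat_size m = sum m D"
    by (rule stat_size_eq_sum[OF fin \<open>degrees m \<subseteq> D\<close>])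
  have m_sum: "sum m D = 1 + (\<Sum>i\<in>D. i * m i)"
    by (rule is_degree_statistic_sum[OF m fin \<open>degrees m \<subseteq> D\<close>])
  have off_D: "n i = 0" "m i = 0" if "i \<notin> D" for i
    using that less.prems(1) \<open>degrees m \<subseteq> D\<close> by (auto simp: degrees_def)
  have fin_n: "finite (degrees n)"
    using fin less.prems(1) finite_subset by blast
  have P_zero: "P = 0" if "i \<in> D" "n i < q * m i" for i
    unfolding P_def using fin that by (intro prod_zero bexI[of _ i]) (simp_all add: inv_fact_diff_def)
  show ?case
  proof (cases k)
    case 0
    with less.prems(3) show ?thesis by (auto simp: marked_forests_0)
  next
    case (Suc k')
    \<comment> \<open>The side condition \<open>ne\<close> excludes the empty forest without marks, for which the formula would
      give \<open>0\<close> instead of \<open>1\<close>.\<close>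
    have IH1: "fact q * real (marked_forests m q (k' + i) (n(i := n i - 1))) =
        c ^ q * real (k' + i) * fact (s - 1 + q - q * stat_size m - 1) * ((real (n i) - real (q * m i)) * P)"
      if i: "i \<in> degrees n" and ne: "k' + i > 0 \<or> q > 0 \<or> n(i := n i - 1) \<noteq> (\<lambda>_. 0)" for i
    proof -
      let ?n = "n(i := n i - 1)"
      have iD: "i \<in> D" and ni: "n i > 0" using i less.prems(1) by (auto simp: degrees_def)
      have split: "sum f D = f i + sum f (D - {i})" for f :: "nat \<Rightarrow> nat"
        using fin iD by (rule sum.remove)
      have s': "sum ?n D = s - 1" "s > 0"
        using ni by (simp_all add: s_def split)
      have "(\<Sum>j\<in>D. j * ?n j) + i = (\<Sum>j\<in>D. j * n j)"
        using ni by (cases "n i") (simp_all add: split)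
      with less.prems(2) s' have "sum ?n D = k' + i + (\<Sum>j\<in>D. j * ?n j)"
        by (simp add: s_def Suc)
      moreover have "degrees ?n \<subseteq> D"
        using less.prems(1) iD by (auto simp: degrees_def)
      moreover have "sum ?n D < sum n D"
        using s' by (simp add: s_def)
      moreover have "(\<Prod>j\<in>D. inv_fact_diff (?n j) (q * m j)) = (real (n i) - real (q * m i)) * P"
        unfolding P_def using inv_fact_diff_pred[OF ni, of "q * m i"]
        by (simp add: prod.remove[OF fin iD])
      ultimately show ?thesis
        using less.hyps[of ?n "k' + i" q] ne s' by (simp add: c_def)
    qed
    have IH2: "fact q * (c * real (marked_forests m (q - 1) k' (\<lambda>i. n i - m i))) =
        real q * c ^ q * real k' * fact (s + q - q * stat_size m - 2) * P"
      if q: "q > 0" and le: "\<forall>i. m i \<le> n i" and ne: "k' > 0 \<or> q > 1 \<or> (\<lambda>i. n i - m i) \<noteq> (\<lambda>_. 0)"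
    proof -
      let ?n = "\<lambda>i. n i - m i"
      have eq: "sum ?n D + sum m D = s"
        using le by (simp add: s_def flip: sum.distrib)
      have "(\<Sum>j\<in>D. j * ?n j) + (\<Sum>j\<in>D. j * m j) = (\<Sum>j\<in>D. j * n j)"
        using le by (simp flip: sum.distrib distrib_left)
      then have "sum ?n D = k' + (\<Sum>j\<in>D. j * ?n j)"
        using less.prems(2) eq m_sum by (simp add: s_def Suc)
      moreover have "degrees ?n \<subseteq> D"
        using less.prems(1) by (auto simp: degrees_def)
      moreover have "sum ?n D < sum n D"
        using eq m_sum by (simp add: s_def)
      moreover have "(\<Prod>j\<in>D. inv_fact_diff (?n j) ((q - 1) * m j)) = P"
        unfolding P_def
      proof (rule prod.cong[OF refl])
        fix j
        from q obtain q' where "q = Suc q'" by (cases q) auto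
        with le[rule_format, of j]
        show "inv_fact_diff (n j - m j) ((q - 1) * m j) = inv_fact_diff (n j) (q * m j)"
          by (auto simp: inv_fact_diff_def)
      qed
      ultimately have "fact (q - 1) * real (marked_forests m (q - 1) k' ?n) =
          c ^ (q - 1) * real k' * fact (sum ?n D + (q - 1) - (q - 1) * stat_size m - 1) * P"
        using less.hyps[of ?n k' "q - 1"] ne q by (auto simp: c_def)
      moreover have "sum ?n D + (q - 1) - (q - 1) * stat_size m - 1 = s + q - q * stat_size m - 2"
        using q by (cases q) (auto simp: m_size simp flip: eq)
      moreover have "fact q = real q * fact (q - 1)" "c ^ q = c * c ^ (q - 1)"
        using q by (cases q; simp)+
      ultimately show ?thesis
        by (simp add: algebra_simps)
    qed
    \<comment> \<open>The recursion meets the empty forest without marks exactly for a single vertex without marks and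
      for a single tree with statistic \<open>m\<close> that is marked at its root.\<close>
    consider (A) "k' = 0" "q = 0" "n = (\<lambda>i. of_bool (i = 0))" | (B) "k' = 0" "q = 1" "n = m"
      | (C) "\<not> (k' = 0 \<and> q = 0 \<and> n = (\<lambda>i. of_bool (i = 0)))" "\<not> (k' = 0 \<and> q = 1 \<and> n = m)"
      by blast
    then show ?thesis
    proof cases
      case A
      have "degrees n = {0}" by (auto simp: A degrees_def)
      with less.prems(1) have "0 \<in> D" by blast
      have "n(0 := n 0 - 1) = (\<lambda>_. 0)" by (auto simp: A(3))
      then have "marked_forests m 0 0 (n(0 := n 0 - 1)) = 1" by (simp only: marked_forests_0) simp
      then have "marked_forests m q (Suc k') n = 1"
        unfolding marked_forests_Suc[OF fin_n] \<open>degrees n = {0}\<close> A(1,2) by simp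
      moreover have "sum n D = 1"
        using fin \<open>0 \<in> D\<close> by (simp add: A(3) of_bool_def)
      moreover have "(\<Prod>i\<in>D. inv_fact_diff (n i) (q * m i)) = 1"
        by (rule prod.neutral) (auto simp: inv_fact_diff_def A)
      ultimately show ?thesis
        by (simp add: Suc A(1,2))
    next
      case B
      have "marked_forests m q (k' + i) (n(i := n i - 1)) = 0" if "i \<in> degrees n" for i
      proof -
        have "i \<in> D" "n i > 0" using that less.prems(1) by (auto simp: degrees_def)
        with IH1[OF that] show ?thesis
          by (auto simp: B(2,3))
      qed
      then have "marked_forests m q (Suc k') n = card (trees m)"
        by (subst marked_forests_Suc[OF fin_n]) (simp add: B marked_forests_0)
      moreover have "(\<Prod>i\<in>D. inv_fact_diff (n i) (q * m i)) = 1"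
        by (rule prod.neutral) (auto simp: inv_fact_diff_def B)
      ultimately show ?thesis
        by (simp add: Suc B m_size)
    next
      case C
      have ne1: "k' + i > 0 \<or> q > 0 \<or> n(i := n i - 1) \<noteq> (\<lambda>_. 0)" if "i \<in> degrees n" for i
      proof (rule ccontr)
        assume *: "\<not> ?thesis"
        then have "k' = 0" "q = 0" "i = 0" and eq: "n(i := n i - 1) = (\<lambda>_. 0)" by auto
        have off: "n j = 0" if "j \<noteq> 0" for j
          using fun_cong[OF eq, of j] \<open>i = 0\<close> that by simp
        have "sum n D = sum n (D \<inter> {0})"
          by (rule sum.mono_neutral_right) (use fin off in auto)
        then have "sum n D = n 0"
          using off_D(1)[of 0] by (cases "0 \<in> D") auto
        moreover have "(\<Sum>j\<in>D. j * n j) = 0"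
          using off by (intro sum.neutral ballI) (metis mult_eq_0_iff)
        ultimately have "n 0 = 1"
          using less.prems(2) Suc \<open>k' = 0\<close> by simp
        then have "n = (\<lambda>i. of_bool (i = 0))"
          by (intro ext) (simp add: off)
        with * C(1) show False by auto
      qed
      have ne2: "k' > 0 \<or> q > 1 \<or> (\<lambda>i. n i - m i) \<noteq> (\<lambda>_. 0)" if "q > 0" "\<forall>i. m i \<le> n i"
      proof (rule ccontr)
        assume *: "\<not> ?thesis"
        then have "n i - m i = 0" for i by (metis (no_types))
        with that(2) have "n i = m i" for i by (metis diff_is_0_eq le_antisym)
        then have "n = m" by (rule ext)
        with * C(2) that(1) show False by auto
      qed
      define S1 where "S1 = (\<Sum>i\<in>degrees n. fact q * real (marked_forests m q (k' + i) (n(i := n i - 1))))"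
      define S2 where "S2 = (if q > 0 \<and> (\<forall>i. m i \<le> n i)
          then fact q * (c * real (marked_forests m (q - 1) k' (\<lambda>i. n i - m i))) else 0)"
      have main: "fact q * real (marked_forests m q k n) = S1 + S2"
        unfolding Suc by (subst marked_forests_Suc[OF fin_n])
          (simp add: S1_def S2_def c_def sum_distrib_left distrib_left)
      show ?thesis
      proof (cases "P = 0")
        case True
        have "S1 = 0" "S2 = 0"
          using IH1 ne1 IH2 ne2 True by (simp_all add: S1_def S2_def)
        with main True show ?thesis
          by (simp add: P_def)
      next
        case False
        then have le: "q * m i \<le> n i" for i
          using P_zero[of i] off_D[of i] by (cases "i \<in> D") (auto simp: not_less[symmetric])
        define a where "a i = n i - q * m i" for i
        have n_eq: "n i = a i + q * m i" for i
          using le[of i] by (simp add: a_def)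
        define M where "M = sum a D + q"
        have s_eq: "s = sum a D + q * stat_size m"
          by (simp add: s_def n_eq sum.distrib m_size sum_distrib_left)
        have "(\<Sum>i\<in>D. i * n i) = (\<Sum>i\<in>D. i * a i) + q * (\<Sum>i\<in>D. i * m i)"
          by (simp add: n_eq sum.distrib sum_distrib_left algebra_simps)
        then have "sum a D + q * (1 + (\<Sum>i\<in>D. i * m i)) = Suc k' + (\<Sum>i\<in>D. i * a i) + q * (\<Sum>i\<in>D. i * m i)"
          using less.prems(2) s_eq m_sum m_size by (simp add: s_def Suc)
        then have M_eq: "M = Suc k' + (\<Sum>i\<in>D. i * a i)"
          by (simp add: M_def)
        have "M \<noteq> 1"
        proof
          assume M1: "M = 1"
          with M_eq have k0: "k' = 0" and i0: "\<forall>i\<in>D. i * a i = 0"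
            using fin by simp_all
          have "a i = 0" if "i \<noteq> 0" for i
            using i0 that off_D[of i] by (cases "i \<in> D") (auto simp: a_def)
          then have sa: "sum a D = (if 0 \<in> D then a 0 else 0)"
          proof -
            have "sum a D = (\<Sum>j\<in>D. if j = 0 then a j else 0)"
              using \<open>\<And>i. i \<noteq> 0 \<Longrightarrow> a i = 0\<close> by (intro sum.cong) auto
            then show ?thesis using fin by simp
          qed
          show False
          proof (cases "q = 0")
            case True
            with M1 have "sum a D = 1" by (simp add: M_def)
            with sa have "a 0 = 1" by (auto split: if_splits)
            then have "n = (\<lambda>i. of_bool (i = 0))"
              using \<open>\<And>i. i \<noteq> 0 \<Longrightarrow> a i = 0\<close> True by (auto simp: n_eq)
            with C k0 True show False by simp
          next
            case False
            with M1 have "q = 1" "sum a D = 0" by (simp_all add: M_def)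
            have "n i = m i" for i
            proof (cases "i \<in> D")
              case True
              with \<open>sum a D = 0\<close> fin have "a i = 0" by simp
              with \<open>q = 1\<close> show ?thesis using n_eq[of i] by simp
            qed (simp add: off_D)
            then have "n = m" by (rule ext)
            with C k0 \<open>q = 1\<close> show False by simp
          qed
        qed
        with M_eq obtain M' where M': "M = Suc (Suc M')"
          by (metis One_nat_def Suc_pred add_Suc not_gr0)
        have facts: "s - 1 + q - q * stat_size m - 1 = M'" "s + q - q * stat_size m - 2 = M'"
            "s + q - q * stat_size m - 1 = Suc M'"
        proof -
          have "s > 0" using less.prems(2) Suc by (simp add: s_def)
          then show "s - 1 + q - q * stat_size m - 1 = M'" "s + q - q * stat_size m - 2 = M'"
            "s + q - q * stat_size m - 1 = Suc M'"
            using M' s_eq M_def by linarith+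
        qed
        have "S1 = (\<Sum>i\<in>degrees n. c ^ q * real (k' + i) * fact M' * (real (a i) * P))"
          unfolding S1_def using IH1 ne1 facts by (intro sum.cong) (simp_all add: n_eq)
        also have "\<dots> = (\<Sum>i\<in>D. c ^ q * real (k' + i) * fact M' * (real (a i) * P))"
          using fin less.prems(1) by (intro sum.mono_neutral_left) (auto simp: degrees_def n_eq)
        also have "\<dots> = c ^ q * fact M' * P * real (\<Sum>i\<in>D. (k' + i) * a i)"
          by (simp add: sum_distrib_left mult_ac)
        also have "(\<Sum>i\<in>D. (k' + i) * a i) = k' * sum a D + (\<Sum>i\<in>D. i * a i)"
          by (simp add: sum.distrib sum_distrib_left distrib_right)
        finally have S1: "S1 = c ^ q * fact M' * P * real (k' * sum a D + (\<Sum>i\<in>D. i * a i))" .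
        have "m i \<le> n i" if "q > 0" for i
          using le[of i] that by (metis One_nat_def Suc_leI le_trans mult_le_mono1 nat_mult_1)
        then have S2: "S2 = c ^ q * fact M' * P * real (q * k')"
          unfolding S2_def using IH2 ne2 facts by (auto simp: mult_ac)
        have "(k' * sum a D + (\<Sum>i\<in>D. i * a i)) + q * k' = Suc k' * Suc M'"
        proof -
          have "(k' * sum a D + (\<Sum>i\<in>D. i * a i)) + q * k' = k' * M + (\<Sum>i\<in>D. i * a i)"
            by (simp add: M_def algebra_simps)
          also have "\<dots> = Suc k' * Suc M'" using M_eq M' by simp
          finally show ?thesis .
        qed
        then have "S1 + S2 = c ^ q * fact M' * P * real (Suc k' * Suc M')"
          unfolding S1 S2 by (simp only: of_nat_add[symmetric] distrib_left[symmetric])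
        also have "\<dots> = c ^ q * real k * fact (Suc M') * P"
          by (simp add: Suc algebra_simps)
        finally show ?thesis
          unfolding main s_def[symmetric] facts(3) P_def[symmetric] c_def[symmetric] .
      qed
    qed
  qed
qed

section \<open>Factorial moments of the fringe count\<close>

definition falling :: "real \<Rightarrow> nat \<Rightarrow> real" where
  "falling x q = (\<Prod>j<q. x - real j)"

lemma falling_0 [simp]: "falling x 0 = 1"
  by (simp add: falling_def)

lemma falling_Suc: "falling x (Suc q) = (x - real q) * falling x q"
  by (simp add: falling_def mult.commute)

lemma falling_of_nat: "falling (real n) q = fact q * real (n choose q)"
proof -
  have "real (n choose q) = (\<Prod>j<q. real n - real j) / fact q"
    unfolding binomial_gbinomial gbinomial_prod_rev by (simp add: atLeast0LessThan)
  then show ?thesis by (simp add: falling_def)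
qed

lemma falling_of_nat_nonneg: "falling (real n) q \<ge> 0"
  by (simp add: falling_of_nat)

lemma falling_eq_inv_fact_diff: "falling (real n) q = fact n * inv_fact_diff n q"
  by (auto simp: falling_of_nat inv_fact_diff_def binomial_fact)

lemma falling_of_nat_eq_0_iff: "falling (real n) q = 0 \<longleftrightarrow> n < q"
  by (auto simp: falling_of_nat not_less[symmetric])

lemma sum_forests_1: "(\<Sum>F\<in>forests 1 n. f F) = (\<Sum>T\<in>trees n. f [T])"
proof -
  have "forests 1 n = (\<lambda>T. [T]) ` trees n"
    by (auto simp: forests_def trees_def length_Suc_conv fun_eq_iff)
  then show ?thesis
    by (simp add: sum.reindex inj_on_def)
qed

lemma stat_size_pos: "is_degree_statistic n \<Longrightarrow> stat_size n > 0"
  by (simp add: is_degree_statistic_def stat_size_def)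

lemma sum_trees_falling:
  assumes n: "is_degree_statistic n" and m: "is_degree_statistic m"
    and D: "finite D" "degrees n \<subseteq> D" "degrees m \<subseteq> D"
  shows "(\<Sum>T\<in>trees n. falling (real (fringe_count m T)) q) =
    real (card (trees m)) ^ q * fact (stat_size n + q - q * stat_size m - 1) *
    (\<Prod>i\<in>D. inv_fact_diff (n i) (q * m i))"
proof -
  have "(\<Sum>T\<in>trees n. falling (real (fringe_count m T)) q) = fact q * real (marked_forests m q 1 n)"
    by (simp add: falling_of_nat marked_forests_def sum_forests_1 sum_distrib_left del: One_nat_def)
  also have "\<dots> = real (card (trees m)) ^ q * fact (stat_size n + q - q * stat_size m - 1) *
      (\<Prod>i\<in>D. inv_fact_diff (n i) (q * m i))"
    using marked_forests_formula[OF D m is_degree_statistic_sum[OF n D(1,2)], of q]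
    by (simp add: stat_size_eq_sum[OF D(1,2)])
  finally show ?thesis .
qed

lemma card_trees:
  assumes "is_degree_statistic n"
  shows "real (card (trees n)) = fact (stat_size n - 1) * (\<Prod>i\<in>degrees n. inv_fact_diff (n i) 0)"
  using sum_trees_falling[OF assms assms, of "degrees n" 0] assms
  by (simp add: is_degree_statistic_def)

lemma trees_nonempty:
  assumes "is_degree_statistic n"
  shows "trees n \<noteq> {}"
proof -
  have "(\<Prod>i\<in>degrees n. inv_fact_diff (n i) 0) \<noteq> 0"
    by (cases "finite (degrees n)") (auto simp: inv_fact_diff_def)
  then have "real (card (trees n)) \<noteq> 0"
    by (simp add: card_trees[OF assms])
  then show ?thesis by auto
qed

lemma expectation_random_tree:
  assumes "is_degree_statistic n"
  shows "measure_pmf.expectation (random_tree n) f = (\<Sum>T\<in>trees n. f T) / real (card (trees n))"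
  unfolding random_tree_def using trees_nonempty[OF assms] finite_trees
  by (rule integral_pmf_of_set)

text \<open>Numerator and denominator of the expectation are both instances of \<open>marked_forests_formula\<close>, the
latter with no marks. If some \<open>n i\<close> is less than \<open>q m i\<close>, both sides vanish; otherwise the quotients of
factorials are falling factorials.\<close>
lemma expectation_falling_fringe_count:
  assumes n: "is_degree_statistic n" and m: "is_degree_statistic m"
  shows "measure_pmf.expectation (random_tree n) (\<lambda>T. falling (real (fringe_count m T)) q) =
    real (card (trees m)) ^ q * (\<Prod>i\<in>degrees m. falling (real (n i)) (q * m i)) /
      falling (real (stat_size n) - 1) (q * (stat_size m - 1))"
proof -
  define D where "D = degrees n \<union> degrees m"
  have D: "finite D" "degrees n \<subseteq> D" "degrees m \<subseteq> D"
    using n m by (auto simp: D_def is_degree_statistic_def)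
  have prod_eq: "(\<Prod>i\<in>degrees m. falling (real (n i)) (q * m i)) = (\<Prod>i\<in>D. falling (real (n i)) (q * m i))"
    using D by (intro prod.mono_neutral_left) (auto simp: degrees_def)
  have pos: "stat_size n > 0" "stat_size m > 0"
    using n m by (simp_all add: stat_size_pos)
  have card_eq: "real (card (trees n)) = fact (stat_size n - 1) * (\<Prod>i\<in>D. inv_fact_diff (n i) 0)"
    using sum_trees_falling[OF n n D(1,2,2), of 0] by simp
  have fact_prod: "(\<Prod>i\<in>D. fact (n i)) * (\<Prod>i\<in>D. inv_fact_diff (n i) 0) = 1"
    unfolding prod.distrib[symmetric] by (rule prod.neutral) (simp add: inv_fact_diff_def)
  have falling_prod: "(\<Prod>i\<in>D. falling (real (n i)) (q * m i)) =
      (\<Prod>i\<in>D. fact (n i)) * (\<Prod>i\<in>D. inv_fact_diff (n i) (q * m i))"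
    by (simp add: falling_eq_inv_fact_diff prod.distrib)
  show ?thesis
  proof (cases "\<forall>i\<in>D. q * m i \<le> n i")
    case False
    then have "(\<Prod>i\<in>D. falling (real (n i)) (q * m i)) = 0" "(\<Prod>i\<in>D. inv_fact_diff (n i) (q * m i)) = 0"
      using D(1) by (auto simp: falling_of_nat_eq_0_iff inv_fact_diff_def not_le)
    then show ?thesis
      by (simp add: expectation_random_tree[OF n] sum_trees_falling[OF n m D] prod_eq)
  next
    case True
    then have "(\<Sum>i\<in>D. q * m i) \<le> sum n D"
      by (intro sum_mono) auto
    then have le: "q * stat_size m \<le> stat_size n"
      by (simp add: stat_size_eq_sum[OF D(1,2)] stat_size_eq_sum[OF D(1,3)] sum_distrib_left)
    define a where "a = q * (stat_size m - 1)"
    have a_le: "a \<le> stat_size n - 1" and idx: "stat_size n + q - q * stat_size m - 1 = stat_size n - 1 - a"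
    proof -
      have "a + q = q * stat_size m"
        using pos by (cases "stat_size m") (auto simp: a_def)
      then show "stat_size n + q - q * stat_size m - 1 = stat_size n - 1 - a"
        using le by linarith
      show "a \<le> stat_size n - 1"
      proof (cases "q = 0")
        case False
        with \<open>a + q = q * stat_size m\<close> le show ?thesis by linarith
      qed (simp add: a_def)
    qed
    have "falling (real (stat_size n) - 1) a = fact (stat_size n - 1) / fact (stat_size n - 1 - a)"
      using falling_eq_inv_fact_diff[of "stat_size n - 1" a] pos a_le
      by (simp add: inv_fact_diff_def of_nat_diff)
    moreover have "(\<Prod>i\<in>D. inv_fact_diff (n i) 0) = 1 / (\<Prod>i\<in>D. fact (n i))"
      by (simp add: inv_fact_diff_def prod_dividef)
    ultimately show ?thesis
      unfolding expectation_random_tree[OF n] sum_trees_falling[OF n m D] prod_eq falling_prod card_eq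
        a_def[symmetric] idx by simp
  qed
qed

section \<open>Comparison of factorial moments with powers\<close>

lemma trees_weight_eq:
  "trees_weight p m = real (card (trees m)) * (\<Prod>i\<in>degrees m. p i ^ m i)"
proof -
  have "tree_weight p T = (\<Prod>i\<in>degrees m. p i ^ m i)" if "T \<in> trees m" for T
    using that by (auto simp: trees_def tree_weight_def)
  then show ?thesis
    by (simp add: trees_weight_def)
qed

lemma prod_one_minus_bounds:
  fixes x :: "'a \<Rightarrow> real"
  assumes "finite A" "\<And>i. i \<in> A \<Longrightarrow> 0 \<le> x i \<and> x i \<le> 1"
  shows "1 - (\<Sum>i\<in>A. x i) \<le> (\<Prod>i\<in>A. 1 - x i)" "(\<Prod>i\<in>A. 1 - x i) \<le> 1"
proof -
  show "(\<Prod>i\<in>A. 1 - x i) \<le> 1"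
    using assms(2) by (intro prod_le_1) auto
  show "1 - (\<Sum>i\<in>A. x i) \<le> (\<Prod>i\<in>A. 1 - x i)"
    using assms
  proof (induction A rule: finite_induct)
    case (insert a A)
    let ?P = "\<Prod>i\<in>A. 1 - x i"
    have "?P \<le> 1" using insert by (intro prod_le_1) auto
    moreover have "1 - sum x A \<le> ?P" "0 \<le> x a"
      using insert by auto
    moreover have "x a * ?P \<le> x a * 1"
      using calculation by (intro mult_left_mono) auto
    ultimately show ?case
      using insert by (simp add: algebra_simps)
  qed auto
qed

lemma real_le_square: "real k \<le> (real k)\<^sup>2"
  by (metis le_square of_nat_le_iff of_nat_mult power2_eq_square)

text \<open>The shift \<open>b\<close> serves both falling factorials in the factorial moment: \<open>b = 0\<close> for those of \<open>n i\<close> and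
\<open>b = 1\<close> for that of the total size minus one.\<close>
lemma falling_bounds:
  fixes x :: real
  assumes "x > 0" "0 \<le> b" "b \<le> 1" "real a \<le> x"
  shows "falling (x - b) a \<le> x ^ a" "(1 - (real a)\<^sup>2 / x) * x ^ a \<le> falling (x - b) a"
proof -
  define y where "y j = (real j + b) / x" for j
  have y: "0 \<le> y j \<and> y j \<le> real a / x" if "j < a" for j
    using that assms by (auto simp: y_def divide_right_mono)
  have "real a / x \<le> 1" using assms by simp
  with y have y1: "0 \<le> y j \<and> y j \<le> 1" if "j \<in> {..<a}" for j
    using that order_trans by fastforce
  have eq: "falling (x - b) a = (\<Prod>j<a. 1 - y j) * x ^ a"
  proof -
    have "x - b - real j = (1 - y j) * x" for j
      using assms(1) by (simp add: y_def field_simps)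
    then show ?thesis
      by (simp add: falling_def prod.distrib)
  qed
  have "(\<Sum>j<a. y j) \<le> (\<Sum>j<a. real a / x)"
    using y by (intro sum_mono) auto
  then have "1 - (real a)\<^sup>2 / x \<le> (\<Prod>j<a. 1 - y j)"
    using prod_one_minus_bounds(1)[of "{..<a}" y] y1 by (simp add: power2_eq_square)
  then show "(1 - (real a)\<^sup>2 / x) * x ^ a \<le> falling (x - b) a"
    unfolding eq using assms(1) by (intro mult_right_mono) auto
  have "(\<Prod>j<a. 1 - y j) * x ^ a \<le> 1 * x ^ a"
    using prod_one_minus_bounds(2)[of "{..<a}" y] y1 assms(1) by (intro mult_right_mono) auto
  then show "falling (x - b) a \<le> x ^ a"
    by (simp add: eq)
qed

text \<open>Up to the factor \<open>fringe_mean\<close>, this is the quantity whose vanishing is the hypothesis of the limit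
theorem; see \<open>fringe_mean_stat_chi_eq\<close>. It measures how much drawing the degrees of one fringe
tree without replacement differs from drawing them independently.\<close>
definition stat_chi :: "(nat \<Rightarrow> nat) \<Rightarrow> (nat \<Rightarrow> nat) \<Rightarrow> real" where
  "stat_chi n m = (\<Sum>i\<in>degrees m. (real (m i))\<^sup>2 / real (n i))"

lemma stat_chi_nonneg: "stat_chi n m \<ge> 0"
  by (simp add: stat_chi_def sum_nonneg)

lemma stat_size_sq_le:
  assumes "finite (degrees n)" "\<And>i. i \<in> degrees m \<Longrightarrow> n i > 0"
  shows "(real (stat_size m))\<^sup>2 \<le> stat_chi n m * real (stat_size n)"
proof -
  have sub: "degrees m \<subseteq> degrees n"
    using assms(2) by (auto simp: degrees_def)
  have "real (stat_size m) = (\<Sum>i\<in>degrees m. (real (m i) / sqrt (real (n i))) * sqrt (real (n i)))"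
    unfolding stat_size_def of_nat_sum using assms(2) by (intro sum.cong) auto
  then have "(real (stat_size m))\<^sup>2 \<le>
      (\<Sum>i\<in>degrees m. (real (m i) / sqrt (real (n i)))\<^sup>2) * (\<Sum>i\<in>degrees m. (sqrt (real (n i)))\<^sup>2)"
    using Cauchy_Schwarz_ineq_sum by metis
  also have "(\<Sum>i\<in>degrees m. (real (m i) / sqrt (real (n i)))\<^sup>2) = stat_chi n m"
    by (simp add: stat_chi_def power_divide)
  also have "(\<Sum>i\<in>degrees m. (sqrt (real (n i)))\<^sup>2) \<le> real (stat_size n)"
    using sub assms(1) by (simp add: stat_size_def sum_mono2)
  finally show ?thesis
    using stat_chi_nonneg mult_left_mono by fastforce
qed

definition fringe_mean :: "(nat \<Rightarrow> nat) \<Rightarrow> (nat \<Rightarrow> nat) \<Rightarrow> real" where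
  "fringe_mean n m = real (stat_size n) * trees_weight (stat_prob n) m"

text \<open>After division by the power of the mean, the falling factorials of the \<open>n i\<close> and the falling factorial
in the denominator become products of factors \<open>1 - j / n i\<close> and \<open>1 - j / N\<close>. By the Weierstrass product
inequality the former lose at most \<open>\<Sum>i. (q m i)\<^sup>2 / n i\<close> and the latter at most \<open>(q |m|)\<^sup>2 / N\<close>, which the
Cauchy-Schwarz bound \<open>stat_size_sq_le\<close> subsumes under the same error term.\<close>
lemma expectation_falling_ratio_bounds:
  assumes n: "is_degree_statistic n" and m: "is_degree_statistic m"
    and pos: "fringe_mean n m > 0" and small: "(real q)\<^sup>2 * stat_chi n m < 1"
  defines "R \<equiv> measure_pmf.expectation (random_tree n) (\<lambda>T. falling (real (fringe_count m T)) q)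
                 / fringe_mean n m ^ q"
  shows "1 - (real q)\<^sup>2 * stat_chi n m \<le> R" "R \<le> 1 / (1 - (real q)\<^sup>2 * stat_chi n m)"
proof -
  define N where "N = real (stat_size n)"
  define c where "c = real (card (trees m))"
  define e where "e = (real q)\<^sup>2 * stat_chi n m"
  define a where "a = q * (stat_size m - 1)"
  have fin: "finite (degrees n)" "finite (degrees m)"
    using n m by (auto simp: is_degree_statistic_def)
  have N: "N \<ge> 1" using stat_size_pos[OF n] by (simp add: N_def)
  have m_pos: "stat_size m > 0" using m by (rule stat_size_pos)
  have mean: "fringe_mean n m = N * c * (\<Prod>i\<in>degrees m. (real (n i) / N) ^ m i)"
    by (simp add: fringe_mean_def trees_weight_eq N_def c_def stat_prob_def)
  have n_pos: "n i > 0" if "i \<in> degrees m" for i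
  proof (rule ccontr)
    assume "\<not> n i > 0"
    then have "(\<Prod>i\<in>degrees m. (real (n i) / N) ^ m i) = 0"
      using fin that by (auto simp: degrees_def)
    with pos mean show False by simp
  qed
  have c: "c > 0"
    using trees_nonempty[OF m] finite_trees[of m] by (simp add: c_def card_gt_0_iff)
  have e_lt: "e < 1" using small by (simp add: e_def)
  have e_sum: "e = (\<Sum>i\<in>degrees m. (real (q * m i))\<^sup>2 / real (n i))"
    by (simp add: e_def stat_chi_def sum_distrib_left power_mult_distrib)
  have le_n: "real (q * m i) \<le> real (n i)" if i: "i \<in> degrees m" for i
  proof -
    have "(real (q * m i))\<^sup>2 / real (n i) \<le> e"
      unfolding e_sum using i fin by (intro member_le_sum) auto
    with e_lt have "(real (q * m i))\<^sup>2 / real (n i) < 1" by linarith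
    with n_pos[OF i] have "(real (q * m i))\<^sup>2 < real (n i)"
      by (simp add: divide_less_eq_1)
    moreover have "real (q * m i) \<le> (real (q * m i))\<^sup>2"
      by (rule real_le_square)
    ultimately show ?thesis by simp
  qed
  define x where "x i = falling (real (n i)) (q * m i) / real (n i) ^ (q * m i)" for i
  have x: "1 - (real (q * m i))\<^sup>2 / real (n i) \<le> x i" "x i \<le> 1" "0 \<le> x i" if "i \<in> degrees m" for i
    using falling_bounds[of "real (n i)" 0 "q * m i"] n_pos[OF that] le_n[OF that]
    by (auto simp: x_def field_simps falling_of_nat_nonneg)
  define A where "A = (\<Prod>i\<in>degrees m. x i)"
  have "A \<le> 1" unfolding A_def using x by (intro prod_le_1) auto
  have "1 - e \<le> 1 - (\<Sum>i\<in>degrees m. 1 - x i)"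
    unfolding e_sum using x(1) by (intro diff_left_mono sum_mono) (simp add: algebra_simps)
  also have "\<dots> \<le> A"
    unfolding A_def using prod_one_minus_bounds(1)[of "degrees m" "\<lambda>i. 1 - x i"] fin x by simp
  finally have "1 - e \<le> A" .
  define B where "B = falling (N - 1) a / N ^ a"
  have "(real a)\<^sup>2 \<le> (real (q * stat_size m))\<^sup>2"
    unfolding a_def by (intro power_mono of_nat_mono mult_le_mono) auto
  also have "\<dots> = (real q)\<^sup>2 * (real (stat_size m))\<^sup>2"
    by (simp add: power_mult_distrib)
  also have "\<dots> \<le> (real q)\<^sup>2 * (stat_chi n m * N)"
    unfolding N_def using stat_size_sq_le[OF fin(1) n_pos] by (intro mult_left_mono) auto
  also have "\<dots> = e * N" by (simp add: e_def)
  finally have a_sq: "(real a)\<^sup>2 \<le> e * N" .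
  note a_sq
  also have "e * N \<le> 1 * N"
    using e_lt N by (intro mult_right_mono) auto
  finally have a_le: "real a \<le> N"
    using real_le_square[of a] by linarith
  have a_sq': "(real a)\<^sup>2 / N \<le> e"
    using a_sq N by (simp add: field_simps)
  have fb: "falling (N - 1) a \<le> N ^ a" "(1 - (real a)\<^sup>2 / N) * N ^ a \<le> falling (N - 1) a"
    using falling_bounds[of N 1 a] a_le N by auto
  have B1: "B \<le> 1"
    using fb(1) N by (simp add: B_def)
  have "1 - (real a)\<^sup>2 / N \<le> B"
    unfolding B_def using fb(2) N by (subst pos_le_divide_eq) auto
  with a_sq' have B0: "1 - e \<le> B" by linarith
  note B = B0 B1
  have "R = A / B"
  proof -
    have "(\<Prod>i\<in>degrees m. (real (n i) / N) ^ m i) ^ q = (\<Prod>i\<in>degrees m. real (n i) ^ (q * m i)) / N ^ (q * stat_size m)"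
      by (simp add: power_divide prod_dividef prod_power_distrib stat_size_def sum_distrib_right mult.commute
           flip: power_mult power_sum)
    moreover have "N ^ (q * stat_size m) = N ^ q * N ^ a"
      using m_pos by (cases "stat_size m") (auto simp: a_def power_add)
    ultimately have mean_q: "fringe_mean n m ^ q = c ^ q * (\<Prod>i\<in>degrees m. real (n i) ^ (q * m i)) / N ^ a"
      using N by (simp add: mean power_mult_distrib)
    have "R = c ^ q * (\<Prod>i\<in>degrees m. falling (real (n i)) (q * m i)) / falling (N - 1) a / fringe_mean n m ^ q"
      unfolding R_def expectation_falling_fringe_count[OF n m] by (simp add: N_def c_def a_def)
    then show ?thesis
      unfolding mean_q using c N by (simp add: A_def B_def x_def prod_dividef)
  qed
  have "A \<le> A / B" 
    using B e_lt \<open>1 - e \<le> A\<close> mult_left_le[of B A] by (subst pos_le_divide_eq) auto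
  with \<open>R = A / B\<close> \<open>1 - e \<le> A\<close> show "1 - (real q)\<^sup>2 * stat_chi n m \<le> R"
    by (simp add: e_def)
  have "A / B \<le> 1 / (1 - e)"
    using B e_lt \<open>A \<le> 1\<close> by (intro frac_le) auto
  then show "R \<le> 1 / (1 - (real q)\<^sup>2 * stat_chi n m)"
    by (simp add: \<open>R = A / B\<close> e_def)
qed

section \<open>Poisson limits from factorial moments\<close>

definition has_falling_moments :: "nat pmf \<Rightarrow> bool" where
  "has_falling_moments P \<longleftrightarrow> (\<forall>q. integrable (measure_pmf P) (\<lambda>x. falling (real x) q))"

abbreviation falling_moment :: "nat pmf \<Rightarrow> nat \<Rightarrow> real" where
  "falling_moment P q \<equiv> measure_pmf.expectation P (\<lambda>x. falling (real x) q)"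

text \<open>Multiplying a falling factorial by \<open>x\<close> gives \<open>x (x)\<^sub>q = (x)\<^sub>q\<^sub>+\<^sub>1 + q (x)\<^sub>q\<close>, so the mixed moments of
\<open>x ^ r (x)\<^sub>q\<close> can be reached by induction on \<open>r\<close>, for all \<open>q\<close> at once.\<close>
lemma moments_tendsto_of_falling:
  assumes int: "eventually (\<lambda>k. has_falling_moments (P k)) sequentially" "has_falling_moments Q"
    and lim: "\<And>q. (\<lambda>k. falling_moment (P k) q) \<longlonglongrightarrow> falling_moment Q q"
  shows "(\<lambda>k. measure_pmf.expectation (P k) (\<lambda>x. real x ^ r)) \<longlonglongrightarrow>
    measure_pmf.expectation Q (\<lambda>x. real x ^ r)"
proof -
  have rec: "real x ^ Suc r * falling (real x) q
      = real x ^ r * falling (real x) (Suc q) + real q * (real x ^ r * falling (real x) q)" for x r q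
    by (simp add: falling_Suc algebra_simps)
  have intg: "integrable (measure_pmf P) (\<lambda>x. real x ^ r * falling (real x) q)"
    if "has_falling_moments P" for P r q
    using that
  proof (induction r arbitrary: q)
    case (Suc r)
    then show ?case unfolding rec by (intro Bochner_Integration.integrable_add integrable_mult_right) auto
  qed (simp add: has_falling_moments_def)
  define E where "E P r q = measure_pmf.expectation P (\<lambda>x. real x ^ r * falling (real x) q)" for P r q
  have E_Suc: "E P (Suc r) q = E P r (Suc q) + real q * E P r q" if "has_falling_moments P" for P r q
    unfolding E_def rec using intg[OF that]
    by (subst Bochner_Integration.integral_add) (auto intro: integrable_mult_right)
  have "(\<lambda>k. E (P k) r q) \<longlonglongrightarrow> E Q r q" for q
  proof (induction r arbitrary: q)
    case (Suc r)
    have "(\<lambda>k. E (P k) r (Suc q) + real q * E (P k) r q) \<longlonglongrightarrow> E Q r (Suc q) + real q * E Q r q"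
      by (intro tendsto_intros Suc)
    then show ?case
      unfolding E_Suc[OF int(2)]
      by (rule Lim_transform_eventually) (use int(1) in \<open>eventually_elim, simp add: E_Suc\<close>)
  qed (simp add: E_def lim)
  from this[of 0] show ?thesis by (simp add: E_def)
qed

text \<open>On the closed unit disc around \<open>-1\<close> the remainder of the binomial series is at most the first omitted
term. This bound, unlike the crude bound by the sum of all omitted terms, only involves one factorial moment
once \<open>N\<close> is random.\<close>
lemma binomial_truncation_bound:
  fixes z :: complex
  assumes "norm (1 + z) \<le> 1"
  shows "norm ((1 + z) ^ N - (\<Sum>q<K. of_nat (N choose q) * z ^ q)) \<le> real (N choose K) * norm z ^ K"
proof (cases K)
  case 0
  with assms show ?thesis by (simp add: norm_power power_le_one)
next
  case (Suc L)
  show ?thesis unfolding Suc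
  proof (induction N)
    case 0
    have "(\<Sum>q<Suc L. of_nat (0 choose q) * z ^ q) = 1"
      by (subst sum.lessThan_Suc_shift) simp
    then show ?case by simp
  next
    case (Suc N)
    let ?s = "\<lambda>N K. \<Sum>q<K. of_nat (N choose q) * z ^ q"
    have shift: "?s N (Suc L) = 1 + (\<Sum>q<L. of_nat (N choose Suc q) * z ^ Suc q)"
      by (subst sum.lessThan_Suc_shift) simp
    have "?s (Suc N) (Suc L) = 1 + (\<Sum>q<L. of_nat (N choose q) * z ^ Suc q) + (\<Sum>q<L. of_nat (N choose Suc q) * z ^ Suc q)"
      by (subst sum.lessThan_Suc_shift) (simp add: distrib_right sum.distrib add.assoc)
    also have "\<dots> = z * ?s N L + ?s N (Suc L)"
      unfolding shift by (simp add: sum_distrib_left mult_ac)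
    also have "\<dots> = (1 + z) * ?s N (Suc L) - of_nat (N choose L) * z ^ Suc L"
      by (simp add: algebra_simps)
    finally have "(1 + z) ^ Suc N - ?s (Suc N) (Suc L)
        = (1 + z) * ((1 + z) ^ N - ?s N (Suc L)) + of_nat (N choose L) * z ^ Suc L"
      by (simp add: algebra_simps)
    also have "norm \<dots> \<le> norm (1 + z) * norm ((1 + z) ^ N - ?s N (Suc L)) + norm (of_nat (N choose L) * z ^ Suc L)"
      using norm_triangle_ineq[of "(1 + z) * ((1 + z) ^ N - ?s N (Suc L))" "of_nat (N choose L) * z ^ Suc L"]
      by (simp only: norm_mult)
    also have "norm (1 + z) * norm ((1 + z) ^ N - ?s N (Suc L)) \<le> 1 * (real (N choose Suc L) * norm z ^ Suc L)"
      using assms Suc.IH by (intro mult_mono) auto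
    finally show ?case
      by (simp add: norm_mult norm_power algebra_simps)
  qed
qed

lemma real_distribution_distr_pmf: "real_distribution (distr (measure_pmf P) borel (f :: 'a \<Rightarrow> real))"
  by (intro real_distribution.intro real_distribution_axioms.intro measure_pmf.prob_space_distr) auto

lemma char_truncation_bound:
  assumes "has_falling_moments P"
  shows "norm (char (distr (measure_pmf P) borel real) t
      - (\<Sum>q<K. (iexp t - 1) ^ q / fact q * of_real (falling_moment P q)))
    \<le> 2 ^ K / fact K * falling_moment P K"
proof -
  let ?z = "iexp t - 1"
  have intg: "integrable (measure_pmf P) (\<lambda>x. real (x choose q))" for q
  proof -
    have "integrable (measure_pmf P) (\<lambda>x. falling (real x) q / fact q)"
      using assms by (simp add: has_falling_moments_def)
    then show ?thesis by (simp add: falling_of_nat)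
  qed
  have E_eq: "falling_moment P q = fact q * measure_pmf.expectation P (\<lambda>x. real (x choose q))" for q
    by (simp add: falling_of_nat)
  have int1: "integrable (measure_pmf P) (\<lambda>x. (1 + ?z) ^ x)"
    by (rule measure_pmf.integrable_const_bound[where B = 1]) (auto simp: norm_power)
  have int2: "integrable (measure_pmf P) (\<lambda>x. of_nat (x choose q) * ?z ^ q)" for q
    using integrable_of_real[OF intg[of q], where 'a = complex] by (intro integrable_mult_left) simp
  have "iexp (t * real x) = (1 + ?z) ^ x" for x
    by (simp add: exp_of_nat_mult[symmetric] mult_ac)
  then have "char (distr (measure_pmf P) borel real) t = measure_pmf.expectation P (\<lambda>x. (1 + ?z) ^ x)"
    unfolding char_def by (subst integral_distr) auto
  moreover have "measure_pmf.expectation P (\<lambda>x. of_nat (x choose q) * ?z ^ q)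
      = ?z ^ q / fact q * of_real (falling_moment P q)" for q
  proof -
    have "measure_pmf.expectation P (\<lambda>x. complex_of_real (real (x choose q)))
        = of_real (measure_pmf.expectation P (\<lambda>x. real (x choose q)))"
      by (rule integral_complex_of_real)
    then show ?thesis by (simp add: E_eq)
  qed
  ultimately have "char (distr (measure_pmf P) borel real) t
      - (\<Sum>q<K. ?z ^ q / fact q * of_real (falling_moment P q))
      = measure_pmf.expectation P (\<lambda>x. (1 + ?z) ^ x - (\<Sum>q<K. of_nat (x choose q) * ?z ^ q))"
    using int1 int2 by (simp add: Bochner_Integration.integral_diff Bochner_Integration.integral_sum)
  also have "norm \<dots> \<le> measure_pmf.expectation P (\<lambda>x. norm ((1 + ?z) ^ x - (\<Sum>q<K. of_nat (x choose q) * ?z ^ q)))"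
    by (rule integral_norm_bound)
  also have "\<dots> \<le> measure_pmf.expectation P (\<lambda>x. real (x choose K) * 2 ^ K)"
  proof (rule integral_mono)
    show "integrable (measure_pmf P) (\<lambda>x. norm ((1 + ?z) ^ x - (\<Sum>q<K. of_nat (x choose q) * ?z ^ q)))"
      using int1 int2 by (intro integrable_norm Bochner_Integration.integrable_diff Bochner_Integration.integrable_sum)
    show "integrable (measure_pmf P) (\<lambda>x. real (x choose K) * 2 ^ K)"
      using intg by simp
    fix x
    have "norm ?z \<le> 2"
      using norm_triangle_ineq4[of "iexp t" 1] by simp
    then have "real (x choose K) * norm ?z ^ K \<le> real (x choose K) * 2 ^ K"
      by (intro mult_left_mono power_mono) auto
    with binomial_truncation_bound[of ?z x K]
    show "norm ((1 + ?z) ^ x - (\<Sum>q<K. of_nat (x choose q) * ?z ^ q)) \<le> real (x choose K) * 2 ^ K"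
      by simp
  qed
  also have "\<dots> = 2 ^ K / fact K * falling_moment P K"
    by (simp add: E_eq)
  finally show ?thesis .
qed

text \<open>Only finitely many factorial moments enter the truncated characteristic function, and the truncation
error is itself a factorial moment, so it also converges. Thus no uniform control of the factorial
moments of high order is required before applying the continuity theorem of Levy.\<close>
lemma weak_conv_of_falling_moments:
  assumes int: "eventually (\<lambda>k. has_falling_moments (P k)) sequentially" "has_falling_moments Q"
    and lim: "\<And>q. (\<lambda>k. falling_moment (P k) q) \<longlonglongrightarrow> falling_moment Q q"
    and small: "(\<lambda>K. 2 ^ K / fact K * falling_moment Q K) \<longlonglongrightarrow> 0"
  shows "weak_conv_m (\<lambda>k. distr (measure_pmf (P k)) borel real) (distr (measure_pmf Q) borel real)"
proof (rule levy_continuity[OF real_distribution_distr_pmf real_distribution_distr_pmf])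
  fix t
  define c where "c P = char (distr (measure_pmf P) borel real) t" for P
  define s where "s P K = (\<Sum>q<K. (iexp t - 1) ^ q / fact q * of_real (falling_moment P q))" for P K
  define b where "b P K = 2 ^ K / fact K * falling_moment P K" for P K
  have "(\<lambda>k. c (P k)) \<longlonglongrightarrow> c Q"
  proof (rule LIMSEQ_I)
    fix e :: real assume "e > 0"
    then have "eventually (\<lambda>K. b Q K < e / 8) sequentially"
      using order_tendstoD(2)[OF small, of "e / 8"] by (simp add: b_def)
    then obtain K where K: "b Q K < e / 8"
      by (auto simp: eventually_sequentially)
    have "(\<lambda>k. b (P k) K) \<longlonglongrightarrow> b Q K"
      unfolding b_def by (intro tendsto_intros lim)
    then have ev1: "eventually (\<lambda>k. b (P k) K < e / 8) sequentially"
      using K by (rule order_tendstoD)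
    have "(\<lambda>k. s (P k) K) \<longlonglongrightarrow> s Q K"
      unfolding s_def by (intro tendsto_intros lim)
    then have ev2: "eventually (\<lambda>k. dist (s (P k) K) (s Q K) < e / 4) sequentially"
      using \<open>e > 0\<close> by (intro tendstoD) auto
    have "eventually (\<lambda>k. norm (c (P k) - c Q) < e) sequentially"
      using ev1 ev2 int(1)
    proof eventually_elim
      case (elim k)
      have "norm (c (P k) - s (P k) K) \<le> b (P k) K" "norm (c Q - s Q K) \<le> b Q K"
        unfolding c_def s_def b_def using char_truncation_bound elim(3) int(2) by blast+
      moreover have "norm (s (P k) K - s Q K) < e / 4"
        using elim(2) by (simp add: dist_norm)
      moreover have "norm (c (P k) - c Q)
          \<le> norm (c (P k) - s (P k) K) + norm (s (P k) K - s Q K) + norm (c Q - s Q K)"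
        using norm_triangle_ineq[of "c (P k) - s (P k) K" "s (P k) K - s Q K"]
          norm_triangle_ineq4[of "c (P k) - s (P k) K + (s (P k) K - s Q K)" "c Q - s Q K"]
        by simp
      ultimately show ?case
        using elim(1) K \<open>e > 0\<close> by linarith
    qed
    then show "\<exists>no. \<forall>n\<ge>no. norm (c (P n) - c Q) < e"
      by (simp add: eventually_sequentially)
  qed
  then show "(\<lambda>k. char (distr (measure_pmf (P k)) borel real) t) \<longlonglongrightarrow> char (distr (measure_pmf Q) borel real) t"
    by (simp add: c_def)
qed

lemma poisson_falling_moment:
  assumes "lam > 0"
  shows "integrable (measure_pmf (poisson_pmf lam)) (\<lambda>x. falling (real x) q)"
    and "falling_moment (poisson_pmf lam) q = lam ^ q"
proof -
  have "(\<lambda>x. lam ^ x / fact x) sums exp lam"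
    using exp_converges[of lam] by (simp add: divide_inverse mult.commute)
  then have "(\<lambda>x. lam ^ q * exp (-lam) * (lam ^ x / fact x)) sums (lam ^ q * exp (-lam) * exp lam)"
    by (rule sums_mult)
  moreover have "lam ^ q * exp (-lam) * (lam ^ x / fact x)
      = pmf (poisson_pmf lam) (x + q) * falling (real (x + q)) q" for x
    using assms falling_eq_inv_fact_diff[of "x + q" q]
    by (simp add: inv_fact_diff_def power_add)
  moreover have "lam ^ q * exp (-lam) * exp lam = lam ^ q"
    by (simp add: exp_minus)
  ultimately have "(\<lambda>x. pmf (poisson_pmf lam) (x + q) * falling (real (x + q)) q) sums lam ^ q"
    by (simp only:)
  moreover have "(\<Sum>x<q. pmf (poisson_pmf lam) x * falling (real x) q) = 0"
    by (intro sum.neutral) (auto simp: falling_of_nat_eq_0_iff)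
  ultimately have sums: "(\<lambda>x. pmf (poisson_pmf lam) x * falling (real x) q) sums lam ^ q"
    using sums_iff_shift[of "\<lambda>x. pmf (poisson_pmf lam) x * falling (real x) q" q "lam ^ q"] by simp
  have "integrable (count_space UNIV) (\<lambda>x. pmf (poisson_pmf lam) x * falling (real x) q)"
    using sums by (subst integrable_count_space_nat_iff)
      (auto simp: abs_mult falling_of_nat_nonneg sums_iff)
  note int = this
  show "integrable (measure_pmf (poisson_pmf lam)) (\<lambda>x. falling (real x) q)"
    using int by (simp add: measure_pmf_eq_density integrable_density)
  have "falling_moment (poisson_pmf lam) q = (\<integral>x. pmf (poisson_pmf lam) x * falling (real x) q \<partial>count_space UNIV)"
    by (subst measure_pmf_eq_density, subst integral_density) auto
  also have "\<dots> = lam ^ q"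
    using integral_count_space_nat[OF int] sums by (simp add: sums_iff)
  finally show "falling_moment (poisson_pmf lam) q = lam ^ q" .
qed

lemma poisson_limit:
  assumes "lam > 0"
    and int: "eventually (\<lambda>k. has_falling_moments (P k)) sequentially"
    and lim: "\<And>q. (\<lambda>k. falling_moment (P k) q) \<longlonglongrightarrow> lam ^ q"
  shows "weak_conv_m (\<lambda>k. distr (measure_pmf (P k)) borel real) (distr (poisson_pmf lam) borel real)"
    and "(\<lambda>k. measure_pmf.expectation (P k) (\<lambda>x. real x ^ r)) \<longlonglongrightarrow>
      measure_pmf.expectation (poisson_pmf lam) (\<lambda>x. real x ^ r)"
proof -
  have fm: "has_falling_moments (poisson_pmf lam)"
    using poisson_falling_moment(1)[OF \<open>lam > 0\<close>] by (simp add: has_falling_moments_def)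
  have lim': "(\<lambda>k. falling_moment (P k) q) \<longlonglongrightarrow> falling_moment (poisson_pmf lam) q" for q
    using lim by (simp add: poisson_falling_moment(2)[OF \<open>lam > 0\<close>])
  have "(\<lambda>K. (2 * lam) ^ K / fact K) \<longlonglongrightarrow> 0"
    using summable_LIMSEQ_zero[OF summable_exp[of "2 * lam"]] by (simp add: field_simps)
  then have small: "(\<lambda>K. 2 ^ K / fact K * falling_moment (poisson_pmf lam) K) \<longlonglongrightarrow> 0"
    by (simp add: poisson_falling_moment(2)[OF \<open>lam > 0\<close>] power_mult_distrib)
  show "weak_conv_m (\<lambda>k. distr (measure_pmf (P k)) borel real) (distr (poisson_pmf lam) borel real)"
    by (rule weak_conv_of_falling_moments[OF int fm lim' small])
  show "(\<lambda>k. measure_pmf.expectation (P k) (\<lambda>x. real x ^ r)) \<longlonglongrightarrow>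
      measure_pmf.expectation (poisson_pmf lam) (\<lambda>x. real x ^ r)"
    by (rule moments_tendsto_of_falling[OF int fm lim'])
qed

section \<open>Laws with Gaussian exponential moments on a half line\<close>

lemma exp_partial_sum_bound:
  fixes x :: complex
  shows "norm (\<Sum>n<N. x ^ n / fact n) \<le> exp (norm x)"
    and "norm (x ^ n / fact n) \<le> exp (norm x)"
proof -
  have sums: "(\<lambda>n. norm x ^ n / fact n) sums exp (norm x)"
    using exp_converges[of "norm x"] by (simp add: divide_inverse mult.commute)
  have le: "(\<Sum>n\<in>A. norm x ^ n / fact n) \<le> exp (norm x)" if "finite A" for A
    using sum_le_suminf[OF sums_summable[OF sums] that] sums_unique[OF sums] by simp
  have "norm (\<Sum>n<N. x ^ n / fact n) \<le> (\<Sum>n<N. norm (x ^ n / fact n))"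
    by (rule norm_sum)
  also have "\<dots> \<le> exp (norm x)"
    using le[of "{..<N}"] by (simp add: norm_divide norm_power)
  finally show "norm (\<Sum>n<N. x ^ n / fact n) \<le> exp (norm x)" .
  show "norm (x ^ n / fact n) \<le> exp (norm x)"
    using le[of "{n}"] by (simp add: norm_divide norm_power)
qed

text \<open>Around a real point \<open>a > 0\<close> the integral is a power series in \<open>w\<close>: the partial sums of the exponential
series are dominated by \<open>exp ((a + |w|) z) + exp ((a - |w|) z)\<close>, which is integrable as long as both
exponents stay positive.\<close>
lemma cexp_integral_holomorphic:
  fixes M :: "real measure"
  assumes [measurable_cong]: "sets M = sets borel"
    and int: "\<And>c. c > 0 \<Longrightarrow> integrable M (\<lambda>z. exp (c * z))"
  shows "(\<lambda>w. \<integral>z. exp ((of_real a + w) * of_real z) \<partial>M) holomorphic_on ball 0 a"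
proof -
  define b :: "nat \<Rightarrow> complex" where "b n = (\<integral>z. of_real z ^ n / fact n * exp (of_real (a * z)) \<partial>M)" for n :: nat
  have "(\<lambda>n. b n * (w - 0) ^ n) sums (\<integral>z. exp ((of_real a + w) * of_real z) \<partial>M)" if "w \<in> ball 0 a" for w :: complex
  proof -
    define r where "r = norm w"
    have r: "0 \<le> r" "r < a" using that by (simp_all add: r_def)
    define W where "W z = exp ((a + r) * z) + exp ((a - r) * z)" for z :: real
    have W_int: "integrable M W"
      unfolding W_def using r int[of "a + r"] int[of "a - r"] by simp
    have W_bound: "exp (norm (w * of_real z)) * exp (a * z) \<le> W z" for z :: real
    proof (cases "z \<ge> 0")
      case True
      then have "exp (norm (w * of_real z)) * exp (a * z) = exp ((a + r) * z)"
        by (simp add: norm_mult r_def algebra_simps flip: exp_add)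
      then show ?thesis by (simp add: W_def)
    next
      case False
      then have "exp (norm (w * of_real z)) * exp (a * z) = exp ((a - r) * z)"
        by (simp add: norm_mult r_def algebra_simps flip: exp_add)
      then show ?thesis by (simp add: W_def)
    qed
    define f where "f n z = (w * of_real z) ^ n / fact n * exp (of_real (a * z))" for n and z :: real
    have f_norm: "norm (exp (complex_of_real (a * z))) = exp (a * z)" for z
      by simp
    have f_meas [measurable]: "f n \<in> borel_measurable M" for n
      unfolding f_def by measurable
    have f_int: "integrable M (f n)" for n
    proof (rule Bochner_Integration.integrable_bound[OF W_int])
      show "AE z in M. norm (f n z) \<le> norm (W z)"
      proof (rule AE_I2)
        fix z
        have "norm (f n z) \<le> exp (norm (w * of_real z)) * exp (a * z)"
          unfolding f_def norm_mult[of "_ / _"] f_norm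
          by (intro mult_right_mono exp_partial_sum_bound) auto
        with W_bound[of z] show "norm (f n z) \<le> norm (W z)" by simp
      qed
    qed simp
    have "(\<lambda>N. \<integral>z. (\<Sum>n<N. f n z) \<partial>M) \<longlonglongrightarrow> (\<integral>z. exp ((of_real a + w) * of_real z) \<partial>M)"
    proof (rule integral_dominated_convergence[OF _ _ W_int])
      show "AE z in M. (\<lambda>N. \<Sum>n<N. f n z) \<longlonglongrightarrow> exp ((of_real a + w) * of_real z)"
      proof (rule AE_I2)
        fix z :: real
        have "(\<lambda>n. (w * of_real z) ^ n / fact n) sums exp (w * of_real z)"
          using exp_converges[of "w * of_real z"] by (simp add: scaleR_conv_of_real divide_inverse mult.commute)
        then have "(\<lambda>n. f n z) sums (exp (w * of_real z) * exp (of_real (a * z)))"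
          unfolding f_def by (rule sums_mult2)
        then show "(\<lambda>N. \<Sum>n<N. f n z) \<longlonglongrightarrow> exp ((of_real a + w) * of_real z)"
          by (simp add: sums_def exp_add[symmetric] distrib_right add.commute)
      qed
      show "AE z in M. norm (\<Sum>n<N. f n z) \<le> W z" for N
      proof (rule AE_I2)
        fix z
        have "norm (\<Sum>n<N. f n z) \<le> exp (norm (w * of_real z)) * exp (a * z)"
          unfolding f_def sum_distrib_right[symmetric] norm_mult[of "sum _ _"] f_norm
          by (intro mult_right_mono exp_partial_sum_bound) auto
        with W_bound[of z] show "norm (\<Sum>n<N. f n z) \<le> W z" by simp
      qed
    qed measurable
    moreover have "(\<integral>z. (\<Sum>n<N. f n z) \<partial>M) = (\<Sum>n<N. b n * w ^ n)" for N
    proof -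
      have "f n z = w ^ n * (of_real z ^ n / fact n * exp (of_real (a * z)))" for n z
        by (simp add: f_def power_mult_distrib)
      then have "(\<integral>z. f n z \<partial>M) = w ^ n * b n" for n
        unfolding b_def by simp
      then show ?thesis
        using f_int by (simp add: Bochner_Integration.integral_sum mult.commute)
    qed
    ultimately show ?thesis
      by (simp add: sums_def)
  qed
  then show ?thesis
    by (rule power_series_holomorphic)
qed

text \<open>Every point of the open right half plane lies in a disc around some real \<open>a\<close> that touches the
imaginary axis at \<open>0\<close>, and in that disc the identity theorem applies.\<close>
lemma cexp_integral_eq_if_real:
  fixes M :: "real measure"
  assumes M: "sets M = sets borel"
    and mgf: "\<And>c. c > 0 \<Longrightarrow> integrable M (\<lambda>z. exp (c * z))"
      "\<And>c. c > 0 \<Longrightarrow> (\<integral>z. exp (c * z) \<partial>M) = exp (c\<^sup>2 / 2)"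
    and s: "Re s > 0"
  shows "(\<integral>z. exp (s * of_real z) \<partial>M) = exp (s\<^sup>2 / 2)"
proof -
  \<comment> \<open>\<open>|s - a| < a\<close> is equivalent to \<open>|s|\<^sup>2 < 2 a Re s\<close>.\<close>
  define a where "a = (norm s)\<^sup>2 / (2 * Re s) + 1"
  have a: "a > 0" "a > (norm s)\<^sup>2 / (2 * Re s)"
    using s by (auto simp: a_def intro!: add_nonneg_pos)
  have "(norm (s - of_real a))\<^sup>2 = (norm s)\<^sup>2 - 2 * a * Re s + a\<^sup>2"
    unfolding cmod_power2 by (simp add: power2_eq_square algebra_simps)
  also have "\<dots> < a\<^sup>2"
    using a(2) s by (simp add: field_simps)
  finally have s_ball: "s - of_real a \<in> ball 0 a"
    using a(1) by (simp add: power_less_imp_less_base)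
  define h :: "complex \<Rightarrow> complex" where "h w = (\<integral>z. exp ((of_real a + w) * of_real z) \<partial>M) - exp ((of_real a + w)\<^sup>2 / 2)" for w
  have "h (s - of_real a) = 0"
  proof (rule analytic_continuation[where f = h and S = "ball 0 a" and \<xi> = 0 and U = "of_real ` {-a<..<a}"])
    show "h holomorphic_on ball 0 a"
      unfolding h_def by (intro holomorphic_intros cexp_integral_holomorphic M mgf(1)) auto
    show "of_real ` {- a<..<a} \<subseteq> ball (0 :: complex) a"
      by (auto simp: dist_norm)
    show "0 islimpt complex_of_real ` {- a<..<a}"
    proof (rule islimptI)
      fix T :: "complex set" assume "0 \<in> T" "open T"
      then obtain e where e: "e > 0" "ball 0 e \<subseteq> T" by (auto simp: open_contains_ball)
      define y where "y = min e a / 2"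
      have "0 < y" "y < e" "y < a" using e a(1) by (auto simp: y_def)
      then have "complex_of_real y \<in> T" "y \<in> {-a<..<a}" "complex_of_real y \<noteq> 0"
        using e by (auto simp: subset_iff dist_norm)
      then show "\<exists>y\<in>complex_of_real ` {- a<..<a}. y \<in> T \<and> y \<noteq> 0" by blast
    qed
    fix w assume "w \<in> complex_of_real ` {- a<..<a}"
    then obtain x where x: "w = of_real x" "-a < x" by auto
    have "(\<integral>z. exp ((of_real a + w) * of_real z) \<partial>M) = (\<integral>z. complex_of_real (exp ((a + x) * z)) \<partial>M)"
      by (simp add: x exp_of_real flip: of_real_add of_real_mult)
    also have "\<dots> = of_real (exp ((a + x)\<^sup>2 / 2))"
      using mgf(2)[of "a + x"] x(2) by (simp del: of_real_exp)
    also have "\<dots> = exp ((of_real a + w)\<^sup>2 / 2)"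
      by (simp add: x flip: exp_of_real)
    finally show "h w = 0" by (simp add: h_def)
  qed (use a(1) s_ball in auto)
  then show ?thesis by (simp add: h_def)
qed

text \<open>Exponential moments on one side suffice, although nothing is known for negative \<open>c\<close>: the identity extends
to the open right half plane and then to its boundary, where it is the characteristic function.\<close>
lemma std_normal_if_mgf_right:
  fixes M :: "real measure"
  assumes M: "real_distribution M"
    and mgf: "\<And>c. c > 0 \<Longrightarrow> integrable M (\<lambda>z. exp (c * z))"
      "\<And>c. c > 0 \<Longrightarrow> (\<integral>z. exp (c * z) \<partial>M) = exp (c\<^sup>2 / 2)"
  shows "M = std_normal_distribution"
proof (rule Levy_uniqueness[OF M real_dist_normal_dist], rule ext)
  interpret real_distribution M by fact
  fix t
  define s where "s n = Complex (inverse (real (Suc n))) t" for n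
  have s_lim: "s \<longlonglongrightarrow> \<i> * of_real t"
  proof -
    have "(\<lambda>n. Complex (inverse (real (Suc n))) t) \<longlonglongrightarrow> Complex 0 t"
      by (intro tendsto_Complex LIMSEQ_inverse_real_of_nat tendsto_const)
    then show ?thesis by (simp add: s_def[abs_def] Complex_eq)
  qed
  have "(\<lambda>n. \<integral>z. exp (s n * of_real z) \<partial>M) \<longlonglongrightarrow> (\<integral>z. exp (\<i> * of_real t * of_real z) \<partial>M)"
  proof (rule integral_dominated_convergence[where w = "\<lambda>z. 1 + exp (1 * z)"])
    show "integrable M (\<lambda>z. 1 + exp (1 * z))"
      using mgf(1)[of 1] by simp
    show "AE z in M. (\<lambda>n. exp (s n * of_real z)) \<longlonglongrightarrow> exp (\<i> * of_real t * of_real z)"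
      by (intro AE_I2 tendsto_intros s_lim)
    show "AE z in M. norm (exp (s n * of_real z)) \<le> 1 + exp (1 * z)" for n
    proof (rule AE_I2)
      fix z :: real
      have d: "0 < inverse (real (Suc n))" "inverse (real (Suc n)) \<le> 1"
        by (auto simp: field_simps)
      have "norm (exp (s n * of_real z)) = exp (inverse (real (Suc n)) * z)"
        by (simp add: s_def)
      also have "\<dots> \<le> 1 + exp (1 * z)"
      proof (cases "z \<ge> 0")
        case True
        then have "inverse (real (Suc n)) * z \<le> 1 * z" using d by (intro mult_right_mono) auto
        then show ?thesis using exp_le_cancel_iff[of "inverse (real (Suc n)) * z" "1 * z"] by linarith
      next
        case False
        then have "inverse (real (Suc n)) * z \<le> 0" using d by (simp add: mult_nonneg_nonpos)
        then show ?thesis using exp_ge_zero[of "1 * z"] by (smt (verit) exp_le_one_iff)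
      qed
      finally show "norm (exp (s n * of_real z)) \<le> 1 + exp (1 * z)" .
    qed
  qed auto
  moreover have "(\<integral>z. exp (s n * of_real z) \<partial>M) = exp ((s n)\<^sup>2 / 2)" for n
    by (rule cexp_integral_eq_if_real) (use mgf in \<open>auto simp: s_def\<close>)
  moreover have "(\<lambda>n. exp ((s n)\<^sup>2 / 2)) \<longlonglongrightarrow> exp ((\<i> * of_real t)\<^sup>2 / 2)"
    by (intro tendsto_intros s_lim) simp
  ultimately have "(\<integral>z. exp (\<i> * of_real t * of_real z) \<partial>M) = exp ((\<i> * of_real t)\<^sup>2 / 2)"
    using LIMSEQ_unique by fastforce
  moreover have "(\<i> * complex_of_real t)\<^sup>2 / 2 = of_real (- (t\<^sup>2) / 2)"
    by (simp add: power_mult_distrib)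
  ultimately show "char M t = char std_normal_distribution t"
    unfolding char_std_normal_distribution char_def
    by (simp add: mult.assoc flip: exp_of_real)
qed

section \<open>Normal limits from factorial moments of growing order\<close>

text \<open>In terms of \<open>z = (x - \<mu>) / sqrt \<mu>\<close> this is the falling factorial \<open>(x)\<^sub>q\<close> divided by \<open>\<mu> ^ q\<close> (\<open>tilt_of_nat\<close>). The
positive part extends it to a nonnegative function on the whole line without changing it at the
points \<open>z\<close> that come from a natural number \<open>x\<close>. For \<open>q\<close> of order \<open>sqrt \<mu>\<close> it is close to an exponential function
of \<open>z\<close> (\<open>tilt_tendsto\<close>).\<close>
definition tilt :: "real \<Rightarrow> nat \<Rightarrow> real \<Rightarrow> real" where
  "tilt \<mu> q z = (\<Prod>j<q. max 0 (1 + z / sqrt \<mu> - real j / \<mu>))"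

lemma tilt_measurable [measurable]: "tilt \<mu> q \<in> borel_measurable borel"
  unfolding tilt_def[abs_def] by measurable

lemma tilt_nonneg: "tilt \<mu> q z \<ge> 0"
  unfolding tilt_def by (intro prod_nonneg) auto

lemma tilt_of_nat:
  assumes "\<mu> > 0"
  shows "tilt \<mu> q ((real x - \<mu>) / sqrt \<mu>) = falling (real x) q / \<mu> ^ q"
proof -
  have eq: "1 + (real x - \<mu>) / sqrt \<mu> / sqrt \<mu> - real j / \<mu> = (real x - real j) / \<mu>" for j
  proof -
    have "sqrt \<mu> * sqrt \<mu> = \<mu>" using assms by simp
    then show ?thesis using assms by (simp add: diff_divide_distrib)
  qed
  have "falling (real x) q / \<mu> ^ q = (\<Prod>j<q. (real x - real j) / \<mu>)"
    by (simp add: falling_def prod_dividef)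
  moreover have "(\<Prod>j<q. max 0 ((real x - real j) / \<mu>)) = (\<Prod>j<q. (real x - real j) / \<mu>)"
  proof (cases "x < q")
    case True
    then have "(\<Prod>j<q. max 0 ((real x - real j) / \<mu>)) = 0"
      by (intro prod_zero bexI[of _ x]) simp_all
    moreover from True have "(\<Prod>j<q. (real x - real j) / \<mu>) = 0"
      by (intro prod_zero bexI[of _ x]) simp_all
    ultimately show ?thesis by (simp only:)
  qed (use assms in \<open>auto intro!: prod.cong simp: max_def\<close>)
  ultimately show ?thesis
    by (simp only: tilt_def eq)
qed

text \<open>For \<open>z > 0\<close> each of the first \<open>q\<close> factors exceeds the corresponding one among the next \<open>q\<close> factors by at
most the ratio \<open>1 + 2 q / \<mu>\<close>, because all factors are at least \<open>1 / 2\<close>. So the square is comparable with the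
product of all \<open>2 q\<close> factors, that is, with a factorial moment of order \<open>2 q\<close>. This is the source of
uniform integrability.\<close>
lemma tilt_square_le:
  assumes \<mu>: "\<mu> > 0" and q: "4 * real q \<le> \<mu>" "real q \<le> C * sqrt \<mu>"
  shows "(tilt \<mu> q z)\<^sup>2 \<le> 1 + exp (2 * C\<^sup>2) * tilt \<mu> (2 * q) z"
proof -
  define a where "a j = max 0 (1 + z / sqrt \<mu> - real j / \<mu>)" for j
  have tilt: "tilt \<mu> k z = (\<Prod>j<k. a j)" for k
    by (simp add: tilt_def a_def)
  have a0: "a j \<ge> 0" for j by (simp add: a_def)
  show ?thesis
  proof (cases "z \<le> 0")
    case True
    then have "z / sqrt \<mu> \<le> 0" using \<mu> by (simp add: divide_nonpos_pos)
    moreover have "real j / \<mu> \<ge> 0" for j using \<mu> by simp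
    ultimately have "a j \<le> 1" for j
      unfolding a_def by (smt (verit))
    then have "tilt \<mu> q z \<le> 1"
      unfolding tilt using a0 by (intro prod_le_1) auto
    then have "(tilt \<mu> q z)\<^sup>2 \<le> 1"
      using tilt_nonneg by (simp add: power_le_one)
    then show ?thesis
      using tilt_nonneg[of \<mu> "2 * q" z] by (smt (verit) exp_ge_zero mult_nonneg_nonneg)
  next
    case False
    have step: "a j \<le> a (q + j) * (1 + 2 * real q / \<mu>)" if "j < q" for j
    proof -
      have "real (q + j) / \<mu> \<le> (2 * real q) / \<mu>"
        using that \<mu> by (intro divide_right_mono) auto
      also have "\<dots> \<le> 1 / 2" using q(1) \<mu> by (simp add: field_simps)
      finally have "real (q + j) / \<mu> \<le> 1 / 2" .
      moreover have "z / sqrt \<mu> \<ge> 0" using False \<mu> by simp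
      ultimately have half: "1 / 2 \<le> 1 + z / sqrt \<mu> - real (q + j) / \<mu>" by linarith
      then have eq: "a (q + j) = 1 + z / sqrt \<mu> - real (q + j) / \<mu>"
        unfolding a_def by (intro max_absorb2) linarith
      have "1 + z / sqrt \<mu> - real j / \<mu> = a (q + j) + real q / \<mu>"
        unfolding eq by (simp add: add_divide_distrib)
      moreover have "real q / \<mu> \<ge> 0" using \<mu> by simp
      ultimately have "a j = a (q + j) + real q / \<mu>"
        using a0[of "q + j"] unfolding a_def[of j] by linarith
      also have "real q / \<mu> \<le> a (q + j) * (2 * real q / \<mu>)"
      proof -
        have "1 * (real q / \<mu>) \<le> (2 * a (q + j)) * (real q / \<mu>)"
          using half eq \<open>real q / \<mu> \<ge> 0\<close> by (intro mult_right_mono) linarith+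
        then show ?thesis by (simp add: mult_ac)
      qed
      finally show ?thesis by (simp add: distrib_left)
    qed
    have "(\<Prod>j<q. a j) \<le> (\<Prod>j<q. a (q + j) * (1 + 2 * real q / \<mu>))"
      using step a0 by (intro prod_mono) auto
    also have "\<dots> = (\<Prod>j<q. a (q + j)) * (1 + 2 * real q / \<mu>) ^ q"
      by (simp add: prod.distrib)
    also have "\<dots> \<le> (\<Prod>j<q. a (q + j)) * exp (2 * C\<^sup>2)"
    proof (rule mult_left_mono)
      have "(1 + 2 * real q / \<mu>) ^ q \<le> exp (2 * real q / \<mu>) ^ q"
        using \<mu> by (intro power_mono exp_ge_add_one_self) auto
      also have "\<dots> = exp (2 * (real q)\<^sup>2 / \<mu>)"
        by (simp add: exp_of_nat_mult[symmetric] power2_eq_square mult_ac)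
      also have "\<dots> \<le> exp (2 * C\<^sup>2)"
      proof -
        have "(real q)\<^sup>2 \<le> (C * sqrt \<mu>)\<^sup>2" using q(2) by (intro power_mono) auto
        also have "\<dots> = C\<^sup>2 * \<mu>" using \<mu> by (simp add: power_mult_distrib)
        finally show ?thesis using \<mu> by (simp add: field_simps)
      qed
      finally show "(1 + 2 * real q / \<mu>) ^ q \<le> exp (2 * C\<^sup>2)" .
    qed (simp add: a0 prod_nonneg)
    finally have le: "(\<Prod>j<q. a j) \<le> (\<Prod>j<q. a (q + j)) * exp (2 * C\<^sup>2)" .
    have "{..<2 * q} = {..<q} \<union> (\<lambda>j. q + j) ` {..<q}"
    proof (intro equalityI subsetI)
      fix x assume "x \<in> {..<2 * q}"
      then show "x \<in> {..<q} \<union> (\<lambda>j. q + j) ` {..<q}"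
        by (cases "x < q") (auto intro!: image_eqI[of x _ "x - q"])
    qed auto
    then have "(\<Prod>j<2 * q. a j) = (\<Prod>j\<in>{..<q} \<union> (\<lambda>j. q + j) ` {..<q}. a j)"
      by simp
    also have "\<dots> = (\<Prod>j<q. a j) * (\<Prod>j\<in>(\<lambda>j. q + j) ` {..<q}. a j)"
      by (rule prod.union_disjoint) auto
    finally have split: "(\<Prod>j<2 * q. a j) = (\<Prod>j<q. a j) * (\<Prod>j<q. a (q + j))"
      by (simp add: prod.reindex)
    have "(tilt \<mu> q z)\<^sup>2 \<le> (\<Prod>j<q. a j) * ((\<Prod>j<q. a (q + j)) * exp (2 * C\<^sup>2))"
      unfolding tilt power2_eq_square[of "prod a {..<q}"]
      by (intro mult_left_mono le prod_nonneg) (simp_all add: a0)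
    then show ?thesis
      unfolding tilt split by (simp add: mult_ac)
  qed
qed

text \<open>Expand the logarithm of the product to first order. The linear terms add up to
\<open>r z - r\<^sup>2 / 2 + r w / 2\<close> with \<open>w = 1 / sqrt \<mu>\<close> and \<open>r = q w\<close>, and the quadratic error is of order \<open>q w\<^sup>2\<close>.\<close>
lemma tilt_tendsto:
  fixes \<mu> z :: "nat \<Rightarrow> real" and q :: "nat \<Rightarrow> nat"
  assumes \<mu>: "filterlim \<mu> at_top sequentially" and \<mu>_pos: "\<And>k. \<mu> k > 0"
    and q: "(\<lambda>k. real (q k) / sqrt (\<mu> k)) \<longlonglongrightarrow> c" and z: "z \<longlonglongrightarrow> z0"
  shows "(\<lambda>k. tilt (\<mu> k) (q k) (z k)) \<longlonglongrightarrow> exp (c * z0 - c\<^sup>2 / 2)"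
proof -
  define w where "w k = 1 / sqrt (\<mu> k)" for k
  define r where "r k = real (q k) * w k" for k
  have w: "w \<longlonglongrightarrow> 0"
    unfolding w_def
    by (intro tendsto_divide_0[OF tendsto_const] filterlim_at_top_imp_at_infinity
        filterlim_compose[OF sqrt_at_top \<mu>])
  have w_pos: "w k > 0" for k using \<mu>_pos by (simp add: w_def)
  have r: "r \<longlonglongrightarrow> c" using q by (simp add: r_def[abs_def] w_def)
  have w2: "(w k)\<^sup>2 = 1 / \<mu> k" for k
    using less_imp_le[OF \<mu>_pos[of k]] by (simp add: w_def power_divide)
  define x where "x k j = z k * w k - real j * (w k)\<^sup>2" for k j
  define b where "b k = (\<bar>z k\<bar> + r k) * w k" for k
  have b: "b \<longlonglongrightarrow> 0"
    unfolding b_def by (rule tendsto_eq_intros r z w refl | simp)+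
  have x_le: "\<bar>x k j\<bar> \<le> b k" if "j < q k" for k j
  proof -
    have "real j * (w k)\<^sup>2 \<le> real (q k) * (w k)\<^sup>2"
      using that by (intro mult_right_mono) auto
    moreover have "\<bar>x k j\<bar> \<le> \<bar>z k * w k\<bar> + \<bar>real j * (w k)\<^sup>2\<bar>"
      unfolding x_def by (rule abs_triangle_ineq4)
    moreover have "\<bar>z k * w k\<bar> + real (q k) * (w k)\<^sup>2 = b k" "\<bar>real j * (w k)\<^sup>2\<bar> = real j * (w k)\<^sup>2"
      using w_pos[of k] by (simp_all add: b_def r_def abs_mult algebra_simps power2_eq_square)
    ultimately show ?thesis by linarith
  qed
  have sum_x: "(\<Sum>j<q k. x k j) = r k * z k - (r k)\<^sup>2 / 2 + r k * w k / 2" for k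
  proof -
    have *: "(\<Sum>j<Q. real j) = real Q * (real Q - 1) / 2" for Q
      by (induction Q) (auto simp: algebra_simps)
    have "(\<Sum>j<q k. x k j) = real (q k) * (z k * w k) - (\<Sum>j<q k. real j) * (w k)\<^sup>2"
      by (simp add: x_def sum_subtractf sum_distrib_right)
    then show ?thesis
      unfolding * by (simp add: r_def power2_eq_square field_simps)
  qed
  define S where "S k = (\<Sum>j<q k. ln (1 + x k j))" for k
  have ev: "eventually (\<lambda>k. b k < 1 / 2) sequentially"
    using b by (rule order_tendstoD) simp
  have tilt_eq: "eventually (\<lambda>k. exp (S k) = tilt (\<mu> k) (q k) (z k)) sequentially"
    using ev
  proof eventually_elim
    case (elim k)
    have "1 + x k j > 0" if "j < q k" for j
      using x_le[OF that] elim by linarith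
    then have "exp (S k) = (\<Prod>j<q k. 1 + x k j)"
      by (simp add: S_def exp_sum)
    also have "\<dots> = tilt (\<mu> k) (q k) (z k)"
      unfolding tilt_def
    proof (intro prod.cong refl)
      fix j assume "j \<in> {..<q k}"
      then have "1 + x k j > 0" using \<open>\<And>j. j < q k \<Longrightarrow> 1 + x k j > 0\<close> by simp
      moreover have "1 + x k j = 1 + z k / sqrt (\<mu> k) - real j / \<mu> k"
        unfolding x_def w2 by (simp add: w_def)
      ultimately show "1 + x k j = max 0 (1 + z k / sqrt (\<mu> k) - real j / \<mu> k)" by simp
    qed
    finally show ?case .
  qed
  have "eventually (\<lambda>k. norm (S k - (\<Sum>j<q k. x k j)) \<le> 2 * r k * (\<bar>z k\<bar> + r k) * b k) sequentially"
    using ev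
  proof eventually_elim
    case (elim k)
    have "\<bar>ln (1 + x k j) - x k j\<bar> \<le> 2 * (b k)\<^sup>2" if "j < q k" for j
    proof -
      have "\<bar>ln (1 + x k j) - x k j\<bar> \<le> 2 * (x k j)\<^sup>2"
        using x_le[OF that] elim by (intro abs_ln_one_plus_x_minus_x_bound) linarith
      also have "\<dots> \<le> 2 * (b k)\<^sup>2"
        using x_le[OF that] by (intro mult_left_mono) (auto simp: abs_le_square_iff[symmetric])
      finally show ?thesis .
    qed
    then have "(\<Sum>j<q k. \<bar>ln (1 + x k j) - x k j\<bar>) \<le> (\<Sum>j<q k. 2 * (b k)\<^sup>2)"
      by (intro sum_mono) auto
    moreover have "\<bar>S k - (\<Sum>j<q k. x k j)\<bar> \<le> (\<Sum>j<q k. \<bar>ln (1 + x k j) - x k j\<bar>)"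
      unfolding S_def sum_subtractf[symmetric] by (rule sum_abs)
    moreover have "real (q k) * (2 * (b k)\<^sup>2) = 2 * r k * (\<bar>z k\<bar> + r k) * b k"
      by (simp add: b_def r_def power2_eq_square mult_ac)
    ultimately show ?case by simp
  qed
  moreover have "(\<lambda>k. 2 * r k * (\<bar>z k\<bar> + r k) * b k) \<longlonglongrightarrow> 0"
    by (rule tendsto_eq_intros r z b refl | simp)+
  ultimately have "(\<lambda>k. S k - (\<Sum>j<q k. x k j)) \<longlonglongrightarrow> 0"
    by (rule Lim_null_comparison)
  moreover have "(\<lambda>k. \<Sum>j<q k. x k j) \<longlonglongrightarrow> c * z0 - c\<^sup>2 / 2"
    unfolding sum_x by (rule tendsto_eq_intros r z w refl | simp)+
  ultimately have "S \<longlonglongrightarrow> c * z0 - c\<^sup>2 / 2"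
    using tendsto_add[of "\<lambda>k. S k - (\<Sum>j<q k. x k j)" 0 sequentially "\<lambda>k. \<Sum>j<q k. x k j"] by simp
  then have "(\<lambda>k. exp (S k)) \<longlonglongrightarrow> exp (c * z0 - c\<^sup>2 / 2)"
    by (rule tendsto_exp)
  then show ?thesis
    by (rule Lim_transform_eventually) (rule tilt_eq)
qed

text \<open>By the theorem of Skorohod the convergence of the standardized variables may be assumed pointwise. Then the
variables \<open>F k\<close>, whose means are the normalized factorial moments, converge pointwise to
\<open>exp (c Y - c\<^sup>2 / 2)\<close>. They are bounded in the square mean by \<open>tilt_square_le\<close>, so their means converge to the
mean of the limit, which is therefore \<open>1\<close>.\<close>
lemma limit_law_mgf:
  fixes P :: "nat \<Rightarrow> nat pmf" and \<mu> :: "nat \<Rightarrow> real" and q :: "nat \<Rightarrow> nat"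
  assumes conv: "weak_conv_m (\<lambda>k. distr (measure_pmf (P k)) borel (\<lambda>x. (real x - \<mu> k) / sqrt (\<mu> k))) M"
    and M: "real_distribution M"
    and fin: "\<And>k. finite (set_pmf (P k))"
    and \<mu>: "filterlim \<mu> at_top sequentially" and \<mu>_pos: "\<And>k. \<mu> k > 0"
    and q: "(\<lambda>k. real (q k) / sqrt (\<mu> k)) \<longlonglongrightarrow> c" and q_le: "\<And>k. real (q k) \<le> c * sqrt (\<mu> k)"
    and lim1: "(\<lambda>k. measure_pmf.expectation (P k) (\<lambda>x. falling (real x) (q k)) / \<mu> k ^ q k) \<longlonglongrightarrow> 1"
    and bd: "\<And>k. measure_pmf.expectation (P k) (\<lambda>x. falling (real x) (2 * q k)) / \<mu> k ^ (2 * q k) \<le> B"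
  shows "integrable M (\<lambda>z. exp (c * z))" "(\<integral>z. exp (c * z) \<partial>M) = exp (c\<^sup>2 / 2)"
proof -
  define Z where "Z k x = (real x - \<mu> k) / sqrt (\<mu> k)" for k and x :: nat
  have rd: "real_distribution (distr (measure_pmf (P k)) borel (Z k))" for k
    by (intro real_distribution.intro real_distribution_axioms.intro measure_pmf.prob_space_distr) auto
  have conv': "weak_conv_m (\<lambda>k. distr (measure_pmf (P k)) borel (Z k)) M"
    using conv by (simp add: Z_def[abs_def])
  obtain \<Omega> :: "real measure" and Y_seq Y where \<Omega>: "prob_space \<Omega>"
    and Y_seq [measurable]: "\<And>k. Y_seq k \<in> borel_measurable \<Omega>"
    and distr_Y_seq: "\<And>k. distr \<Omega> borel (Y_seq k) = distr (measure_pmf (P k)) borel (Z k)"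
    and Y [measurable]: "Y \<in> borel_measurable \<Omega>" and distr_Y: "distr \<Omega> borel Y = M"
    and Y_lim: "\<And>\<omega>. \<omega> \<in> space \<Omega> \<Longrightarrow> (\<lambda>k. Y_seq k \<omega>) \<longlonglongrightarrow> Y \<omega>"
    using Skorohod[OF rd M conv', unfolded measurable_lborel1] by blast
  interpret prob_space \<Omega> by fact
  define F where "F k \<omega> = tilt (\<mu> k) (q k) (Y_seq k \<omega>)" for k \<omega>
  define g where "g \<omega> = exp (c * Y \<omega> - c\<^sup>2 / 2)" for \<omega>
  have F_meas [measurable]: "F k \<in> borel_measurable \<Omega>" for k
    unfolding F_def by measurable
  have g_meas [measurable]: "g \<in> borel_measurable \<Omega>"
    unfolding g_def by measurable
  have F_nonneg: "F k \<omega> \<ge> 0" for k \<omega>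
    by (simp add: F_def tilt_nonneg)
  have F_lim: "(\<lambda>k. F k \<omega>) \<longlonglongrightarrow> g \<omega>" if "\<omega> \<in> space \<Omega>" for \<omega>
    unfolding F_def g_def by (rule tilt_tendsto[OF \<mu> \<mu>_pos q Y_lim[OF that]])
  have transport: "integrable \<Omega> (\<lambda>\<omega>. h (Y_seq k \<omega>))"
      "(\<integral>\<omega>. h (Y_seq k \<omega>) \<partial>\<Omega>) = measure_pmf.expectation (P k) (\<lambda>x. h (Z k x))"
    if [measurable]: "h \<in> borel_measurable borel" for h :: "real \<Rightarrow> real" and k
  proof -
    have "integrable (distr (measure_pmf (P k)) borel (Z k)) h"
      by (subst integrable_distr_eq) (auto intro: integrable_measure_pmf_finite fin)
    then show "integrable \<Omega> (\<lambda>\<omega>. h (Y_seq k \<omega>))"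
      unfolding distr_Y_seq[symmetric] by (subst (asm) integrable_distr_eq) auto
    have "(\<integral>\<omega>. h (Y_seq k \<omega>) \<partial>\<Omega>) = (\<integral>z. h z \<partial>distr \<Omega> borel (Y_seq k))"
      by (subst integral_distr) auto
    also have "\<dots> = measure_pmf.expectation (P k) (\<lambda>x. h (Z k x))"
      unfolding distr_Y_seq by (subst integral_distr) auto
    finally show "(\<integral>\<omega>. h (Y_seq k \<omega>) \<partial>\<Omega>) = measure_pmf.expectation (P k) (\<lambda>x. h (Z k x))" .
  qed
  have F_int: "integrable \<Omega> (F k)" for k
    unfolding F_def by (rule transport) measurable
  have F2_int: "integrable \<Omega> (\<lambda>\<omega>. (F k \<omega>)\<^sup>2)" for k
    unfolding F_def by (rule transport(1)[of "\<lambda>z. (tilt (\<mu> k) (q k) z)\<^sup>2"]) measurable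
  have F_E: "expectation (F k) = measure_pmf.expectation (P k) (\<lambda>x. falling (real x) (q k)) / \<mu> k ^ q k" for k
    unfolding F_def by (subst transport(2)) (simp_all add: Z_def tilt_of_nat[OF \<mu>_pos])
  define B' where "B' = 1 + exp (2 * c\<^sup>2) * B"
  have ev_q: "eventually (\<lambda>k. 4 * real (q k) \<le> \<mu> k) sequentially"
  proof -
    have "eventually (\<lambda>k. (4 * c)\<^sup>2 \<le> \<mu> k) sequentially"
      using \<mu> by (simp add: filterlim_at_top)
    then show ?thesis
    proof eventually_elim
      case (elim k)
      have "4 * c \<le> sqrt (\<mu> k)" using elim by (rule real_le_rsqrt)
      then have "4 * c * sqrt (\<mu> k) \<le> sqrt (\<mu> k) * sqrt (\<mu> k)"
        using \<mu>_pos[of k] by (intro mult_right_mono) auto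
      then show ?case using q_le[of k] \<mu>_pos[of k] by simp
    qed
  qed
  then have F2_E: "eventually (\<lambda>k. expectation (\<lambda>\<omega>. (F k \<omega>)\<^sup>2) \<le> B') sequentially"
  proof eventually_elim
    case (elim k)
    let ?G = "\<lambda>\<omega>. tilt (\<mu> k) (2 * q k) (Y_seq k \<omega>)"
    have G_int: "integrable \<Omega> ?G" by (rule transport) measurable
    have "expectation (\<lambda>\<omega>. (F k \<omega>)\<^sup>2) \<le> expectation (\<lambda>\<omega>. 1 + exp (2 * c\<^sup>2) * ?G \<omega>)"
    proof (rule integral_mono[OF F2_int])
      show "integrable \<Omega> (\<lambda>\<omega>. 1 + exp (2 * c\<^sup>2) * ?G \<omega>)"
        using G_int by simp
      show "(F k \<omega>)\<^sup>2 \<le> 1 + exp (2 * c\<^sup>2) * ?G \<omega>" for \<omega>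
        unfolding F_def by (rule tilt_square_le[OF \<mu>_pos elim q_le])
    qed
    also have "\<dots> = 1 + exp (2 * c\<^sup>2) * expectation ?G"
      using G_int by (simp add: prob_space)
    also have "expectation ?G \<le> B"
      using bd[of k] by (subst transport(2)) (simp_all add: Z_def tilt_of_nat[OF \<mu>_pos])
    finally show ?case by (simp add: B'_def)
  qed
  \<comment> \<open>Truncation at a level \<open>K\<close> changes the mean of \<open>F k\<close> by at most \<open>B' / K\<close> for all large \<open>k\<close>.\<close>
  have trunc_lim: "(\<lambda>k. expectation (\<lambda>\<omega>. min (F k \<omega>) K)) \<longlonglongrightarrow> expectation (\<lambda>\<omega>. min (g \<omega>) K)"
    if "K > 0" for K
  proof (rule integral_dominated_convergence[where w = "\<lambda>_. K"])
    show "AE \<omega> in \<Omega>. (\<lambda>k. min (F k \<omega>) K) \<longlonglongrightarrow> min (g \<omega>) K"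
      by (intro AE_I2 tendsto_intros F_lim)
    show "AE \<omega> in \<Omega>. norm (min (F k \<omega>) K) \<le> K" for k
      using that by (intro AE_I2) (auto simp: F_nonneg)
  qed auto
  have trunc_int: "integrable \<Omega> (\<lambda>\<omega>. min (f \<omega>) K)"
    if [measurable]: "f \<in> borel_measurable \<Omega>" and "K > 0" "\<And>\<omega>. f \<omega> \<ge> 0" for f :: "real \<Rightarrow> real" and K
    by (rule integrable_const_bound[where B = K]) (use that in auto)
  have trunc_bounds: "1 - B' / K \<le> expectation (\<lambda>\<omega>. min (g \<omega>) K)"
      "expectation (\<lambda>\<omega>. min (g \<omega>) K) \<le> 1" if K: "K > 0" for K
  proof -
    have E_lim: "(\<lambda>k. expectation (F k)) \<longlonglongrightarrow> 1"
      unfolding F_E by (rule lim1)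
    have "expectation (\<lambda>\<omega>. min (F k \<omega>) K) \<le> expectation (F k)" for k
      by (intro integral_mono trunc_int F_int) (auto simp: K F_nonneg)
    then show "expectation (\<lambda>\<omega>. min (g \<omega>) K) \<le> 1"
      by (intro LIMSEQ_le[OF trunc_lim[OF K] E_lim]) auto
    have low: "expectation (F k) - expectation (\<lambda>\<omega>. (F k \<omega>)\<^sup>2) / K \<le> expectation (\<lambda>\<omega>. min (F k \<omega>) K)" for k
    proof -
      have "expectation (\<lambda>\<omega>. F k \<omega> - (F k \<omega>)\<^sup>2 / K) \<le> expectation (\<lambda>\<omega>. min (F k \<omega>) K)"
      proof (rule integral_mono)
        show "integrable \<Omega> (\<lambda>\<omega>. F k \<omega> - (F k \<omega>)\<^sup>2 / K)"
          using F_int F2_int by auto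
        show "integrable \<Omega> (\<lambda>\<omega>. min (F k \<omega>) K)"
          by (intro trunc_int) (auto simp: K F_nonneg)
        fix \<omega>
        show "F k \<omega> - (F k \<omega>)\<^sup>2 / K \<le> min (F k \<omega>) K"
        proof (cases "F k \<omega> \<le> K")
          case False
          then have "F k \<omega> * 1 \<le> F k \<omega> * (F k \<omega> / K)"
            using K by (intro mult_left_mono) (auto simp: F_nonneg)
          with False K show ?thesis by (simp add: power2_eq_square)
        qed (use K in \<open>simp add: F_nonneg\<close>)
      qed
      then show ?thesis using F_int F2_int by simp
    qed
    have "(\<lambda>k. expectation (F k) - B' / K) \<longlonglongrightarrow> 1 - B' / K"
      by (intro tendsto_intros E_lim)
    moreover have "eventually (\<lambda>k. expectation (F k) - B' / K \<le> expectation (\<lambda>\<omega>. min (F k \<omega>) K)) sequentially"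
      using F2_E
    proof eventually_elim
      case (elim k)
      then have "expectation (\<lambda>\<omega>. (F k \<omega>)\<^sup>2) / K \<le> B' / K"
        using K by (intro divide_right_mono) auto
      with low[of k] show ?case by linarith
    qed
    ultimately show "1 - B' / K \<le> expectation (\<lambda>\<omega>. min (g \<omega>) K)"
      using trunc_lim[OF K] by (intro tendsto_le[OF sequentially_bot, rotated]) auto
  qed
  have trunc_one: "(\<lambda>i. expectation (\<lambda>\<omega>. min (g \<omega>) (real (Suc i)))) \<longlonglongrightarrow> 1"
  proof (rule tendsto_sandwich)
    show "(\<lambda>i. 1 - B' / real (Suc i)) \<longlonglongrightarrow> 1"
      using tendsto_diff[OF tendsto_const LIMSEQ_Suc[OF lim_const_over_n], of 1 B'] by simp
    show "(\<lambda>_. 1::real) \<longlonglongrightarrow> 1" by simp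
  qed (use trunc_bounds in \<open>auto intro!: always_eventually\<close>)
  have mono: "mono (\<lambda>i. min (g \<omega>) (real (Suc i)))" for \<omega>
    by (intro monoI) (auto simp: min_def)
  have lim: "(\<lambda>i. min (g \<omega>) (real (Suc i))) \<longlonglongrightarrow> g \<omega>" for \<omega>
  proof (rule tendsto_eventually)
    obtain N where "g \<omega> \<le> real N" using real_arch_simple by blast
    then show "eventually (\<lambda>i. min (g \<omega>) (real (Suc i)) = g \<omega>) sequentially"
      unfolding eventually_sequentially by (intro exI[of _ N]) auto
  qed
  have "integrable \<Omega> g" "expectation g = 1"
    by (rule integral_monotone_convergence_nonneg
          [where f = "\<lambda>i \<omega>. min (g \<omega>) (real (Suc i))", OF _ _ _ _ trunc_one g_meas];
        (intro trunc_int AE_I2 mono lim g_meas)?; simp add: g_def)+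
  moreover have eq: "exp (c * Y \<omega>) = exp (c\<^sup>2 / 2) * g \<omega>" for \<omega>
    by (simp add: g_def flip: exp_add)
  ultimately have "integrable \<Omega> (\<lambda>\<omega>. exp (c * Y \<omega>))" "expectation (\<lambda>\<omega>. exp (c * Y \<omega>)) = exp (c\<^sup>2 / 2)"
    unfolding eq by simp_all
  then show "integrable M (\<lambda>z. exp (c * z))" "(\<integral>z. exp (c * z) \<partial>M) = exp (c\<^sup>2 / 2)"
    unfolding distr_Y[symmetric] by (simp_all add: integrable_distr_eq integral_distr)
qed

lemma floor_mult_sqrt_ratio:
  assumes \<mu>: "filterlim \<mu> at_top sequentially" and "\<And>k. \<mu> k > 0" and c: "c > 0"
  shows "(\<lambda>k. real (nat \<lfloor>c * sqrt (\<mu> k)\<rfloor>) / sqrt (\<mu> k)) \<longlonglongrightarrow> c"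
proof (rule tendsto_sandwich)
  have w: "(\<lambda>k. 1 / sqrt (\<mu> k)) \<longlonglongrightarrow> 0"
    by (intro tendsto_divide_0[OF tendsto_const] filterlim_at_top_imp_at_infinity
        filterlim_compose[OF sqrt_at_top \<mu>])
  then show "(\<lambda>k. c - 1 / sqrt (\<mu> k)) \<longlonglongrightarrow> c"
    using tendsto_diff[OF tendsto_const w, of c] by simp
  have "c * sqrt (\<mu> k) \<ge> 0" for k
    using assms(2)[of k] c by simp
  then have bounds: "real (nat \<lfloor>c * sqrt (\<mu> k)\<rfloor>) \<le> c * sqrt (\<mu> k)"
      "c * sqrt (\<mu> k) - 1 \<le> real (nat \<lfloor>c * sqrt (\<mu> k)\<rfloor>)" for k
    by (simp add: of_nat_floor) linarith
  have "(c * sqrt (\<mu> k) - 1) / sqrt (\<mu> k) \<le> real (nat \<lfloor>c * sqrt (\<mu> k)\<rfloor>) / sqrt (\<mu> k)"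
    "real (nat \<lfloor>c * sqrt (\<mu> k)\<rfloor>) / sqrt (\<mu> k) \<le> c * sqrt (\<mu> k) / sqrt (\<mu> k)" for k
    using assms(2)[of k] bounds[of k] by (intro divide_right_mono; simp)+
  moreover have "sqrt (\<mu> k) > 0" for k using assms(2) by simp
  ultimately show
    "eventually (\<lambda>k. c - 1 / sqrt (\<mu> k) \<le> real (nat \<lfloor>c * sqrt (\<mu> k)\<rfloor>) / sqrt (\<mu> k)) sequentially"
    "eventually (\<lambda>k. real (nat \<lfloor>c * sqrt (\<mu> k)\<rfloor>) / sqrt (\<mu> k) \<le> c) sequentially"
    by (auto intro!: always_eventually simp: diff_divide_distrib less_imp_neq[symmetric])
qed simp

text \<open>The second moments give tightness. Along a subsequence with a limit law, factorial moments of order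
\<open>\<lfloor>c sqrt \<mu>\<rfloor>\<close> show that this law has the exponential moments of the standard normal law for all \<open>c > 0\<close>.
Factorial moments of bounded order could not do this: a relative error \<open>o(1)\<close> in them is too coarse to
determine centred moments, which are smaller by powers of \<open>\<mu>\<close>.\<close>
lemma normal_limit:
  fixes P :: "nat \<Rightarrow> nat pmf" and \<mu> :: "nat \<Rightarrow> real"
  assumes fin: "\<And>k. finite (set_pmf (P k))"
    and \<mu>: "filterlim \<mu> at_top sequentially" and \<mu>_pos: "\<And>k. \<mu> k > 0"
    and lim: "\<And>q C. (\<And>k. real (q k) \<le> C * sqrt (\<mu> k)) \<Longrightarrow>
      (\<lambda>k. measure_pmf.expectation (P k) (\<lambda>x. falling (real x) (q k)) / \<mu> k ^ q k) \<longlonglongrightarrow> 1"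
    and second: "\<And>k. measure_pmf.expectation (P k) (\<lambda>x. ((real x - \<mu> k) / sqrt (\<mu> k))\<^sup>2) \<le> B"
  shows "weak_conv_m (\<lambda>k. distr (measure_pmf (P k)) borel (\<lambda>x. (real x - \<mu> k) / sqrt (\<mu> k)))
    std_normal_distribution"
proof -
  define Z where "Z k x = (real x - \<mu> k) / sqrt (\<mu> k)" for k and x :: nat
  define L where "L k = distr (measure_pmf (P k)) borel (Z k)" for k
  have rd: "real_distribution (L k)" for k
    unfolding L_def
    by (intro real_distribution.intro real_distribution_axioms.intro measure_pmf.prob_space_distr) auto
  have tight: "tight L"
    unfolding tight_def
  proof (intro conjI allI impI rd)
    fix e :: real assume e: "e > 0"
    define b where "b = sqrt ((\<bar>B\<bar> + 1) / e) + 1"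
    have b: "b > 0" "\<bar>B\<bar> / (b - 1)\<^sup>2 < e" "b - 1 > 0"
    proof -
      show *: "b - 1 > 0" using e by (simp add: b_def)
      then show "b > 0" by simp
      have "e * (b - 1)\<^sup>2 = \<bar>B\<bar> + 1" using e by (simp add: b_def)
      then show "\<bar>B\<bar> / (b - 1)\<^sup>2 < e"
        by (subst pos_divide_less_eq) (use * in auto)
    qed
    have "measure (L k) {-b<..b} > 1 - e" for k
    proof -
      have "measure_pmf.prob (P k) {x. (Z k x)\<^sup>2 \<ge> (b - 1)\<^sup>2} \<le> B / (b - 1)\<^sup>2"
      proof -
        have "measure_pmf.prob (P k) {x \<in> space (measure_pmf (P k)). (Z k x)\<^sup>2 \<ge> (b - 1)\<^sup>2}
            \<le> measure_pmf.expectation (P k) (\<lambda>x. (Z k x)\<^sup>2) / (b - 1)\<^sup>2"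
          by (rule integral_Markov_inequality_measure[where A = UNIV])
            (use b(3) fin in \<open>auto intro: integrable_measure_pmf_finite\<close>)
        also have "\<dots> \<le> B / (b - 1)\<^sup>2"
          using second[of k] by (intro divide_right_mono) (auto simp: Z_def)
        finally show ?thesis by simp
      qed
      also have "\<dots> \<le> \<bar>B\<bar> / (b - 1)\<^sup>2" by (intro divide_right_mono) auto
      also note b(2)
      finally have "1 - e < 1 - measure_pmf.prob (P k) {x. (Z k x)\<^sup>2 \<ge> (b - 1)\<^sup>2}" by simp
      also have "\<dots> = measure_pmf.prob (P k) (- {x. (Z k x)\<^sup>2 \<ge> (b - 1)\<^sup>2})"
        using measure_pmf.prob_compl[of "{x. (Z k x)\<^sup>2 \<ge> (b - 1)\<^sup>2}" "P k"] by (simp add: Compl_eq_Diff_UNIV)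
      also have "\<dots> \<le> measure_pmf.prob (P k) (Z k -` {-b<..b})"
      proof (rule measure_pmf.finite_measure_mono)
        show "- {x. (b - 1)\<^sup>2 \<le> (Z k x)\<^sup>2} \<subseteq> Z k -` {- b<..b}"
        proof
          fix x assume "x \<in> - {x. (b - 1)\<^sup>2 \<le> (Z k x)\<^sup>2}"
          then have "(Z k x)\<^sup>2 < (b - 1)\<^sup>2" by simp
          then have "\<bar>Z k x\<bar> < b - 1" using power2_less_imp_less[of "\<bar>Z k x\<bar>" "b - 1"] b(3) by simp
          then show "x \<in> Z k -` {- b<..b}" by auto
        qed
      qed simp
      also have "\<dots> = measure (L k) {-b<..b}"
        unfolding L_def by (subst measure_distr) auto
      finally show ?thesis .
    qed
    then show "\<exists>a b. a < b \<and> (\<forall>n. 1 - e < measure (L n) {a<..b})"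
      using b(1) by (intro exI[of _ "-b"] exI[of _ b]) auto
  qed
  have "weak_conv_m L std_normal_distribution"
  proof (rule tight_subseq_weak_converge[OF rd real_dist_normal_dist tight])
    fix s M assume s: "strict_mono (s :: nat \<Rightarrow> nat)" and M: "real_distribution M" and conv: "weak_conv_m (L \<circ> s) M"
    have conv': "weak_conv_m (\<lambda>k. distr (measure_pmf (P (s k))) borel (\<lambda>x. (real x - \<mu> (s k)) / sqrt (\<mu> (s k)))) M"
      using conv by (simp add: L_def Z_def[abs_def] comp_def)
    have mgf: "integrable M (\<lambda>z. exp (c * z)) \<and> (\<integral>z. exp (c * z) \<partial>M) = exp (c\<^sup>2 / 2)" if c: "c > 0" for c
    proof -
      define q where "q k = nat \<lfloor>c * sqrt (\<mu> k)\<rfloor>" for k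
      have q_le: "real (q k) \<le> c * sqrt (\<mu> k)" for k
        unfolding q_def using c \<mu>_pos[of k] by (simp add: of_nat_floor)
      have q2_le: "real (2 * q k) \<le> (2 * c) * sqrt (\<mu> k)" for k
        using q_le[of k] by simp
      have "(\<lambda>k. measure_pmf.expectation (P k) (\<lambda>x. falling (real x) (2 * q k)) / \<mu> k ^ (2 * q k)) \<longlonglongrightarrow> 1"
        by (rule lim[OF q2_le])
      then have "Bseq (\<lambda>k. measure_pmf.expectation (P k) (\<lambda>x. falling (real x) (2 * q k)) / \<mu> k ^ (2 * q k))"
        by (intro convergent_imp_Bseq) (auto simp: convergent_def)
      then obtain B2 where
        "\<And>k. \<bar>measure_pmf.expectation (P k) (\<lambda>x. falling (real x) (2 * q k)) / \<mu> k ^ (2 * q k)\<bar> \<le> B2"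
        unfolding Bseq_def real_norm_def by blast
      then have bd: "measure_pmf.expectation (P k) (\<lambda>x. falling (real x) (2 * q k)) / \<mu> k ^ (2 * q k) \<le> B2" for k
        by (meson abs_le_iff)
      note sub = LIMSEQ_subseq_LIMSEQ[OF _ s, unfolded comp_def]
      have \<mu>s: "filterlim (\<lambda>k. \<mu> (s k)) at_top sequentially"
        by (rule filterlim_compose[OF \<mu> filterlim_subseq[OF s]])
      have q_lim: "(\<lambda>k. real (q (s k)) / sqrt (\<mu> (s k))) \<longlonglongrightarrow> c"
        using sub[OF floor_mult_sqrt_ratio[OF \<mu> \<mu>_pos c]] by (simp add: q_def)
      have l1: "(\<lambda>k. measure_pmf.expectation (P (s k)) (\<lambda>x. falling (real x) (q (s k))) / \<mu> (s k) ^ q (s k)) \<longlonglongrightarrow> 1"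
        using sub[OF lim[OF q_le]] .
      show ?thesis
        using limit_law_mgf[OF conv' M fin \<mu>s \<mu>_pos q_lim q_le l1 bd] by blast
    qed
    then have "M = std_normal_distribution"
      by (intro std_normal_if_mgf_right M) auto
    with conv show "weak_conv_m (L \<circ> s) std_normal_distribution" by simp
  qed
  then show ?thesis
    by (simp add: L_def[abs_def] Z_def[abs_def])
qed

section \<open>Limit laws of the fringe count\<close>

definition fringe_pmf :: "(nat \<Rightarrow> nat) \<Rightarrow> (nat \<Rightarrow> nat) \<Rightarrow> nat pmf" where
  "fringe_pmf n m = map_pmf (fringe_count m) (random_tree n)"

lemma expectation_fringe_pmf:
  fixes f :: "nat \<Rightarrow> real"
  shows "measure_pmf.expectation (fringe_pmf n m) f = measure_pmf.expectation (random_tree n) (\<lambda>T. f (fringe_count m T))"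
  by (simp add: fringe_pmf_def)

lemma distr_fringe_pmf:
  "distr (measure_pmf (fringe_pmf n m)) borel f = distr (measure_pmf (random_tree n)) borel (\<lambda>T. f (fringe_count m T))"
  unfolding fringe_pmf_def map_pmf_rep_eq by (subst distr_distr) (auto simp: comp_def)

lemma finite_set_fringe_pmf: "is_degree_statistic n \<Longrightarrow> finite (set_pmf (fringe_pmf n m))"
  by (simp add: fringe_pmf_def random_tree_def trees_nonempty finite_trees)

lemma has_falling_moments_if_finite: "finite (set_pmf P) \<Longrightarrow> has_falling_moments P"
  by (simp add: has_falling_moments_def integrable_measure_pmf_finite)

lemma fringe_mean_stat_chi_eq:
  assumes n: "is_degree_statistic n" and m: "is_degree_statistic m"
  shows "real (stat_size m) ^ 2 * trees_weight (stat_prob n) m *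
      (\<Sum>i\<in>degrees m. stat_prob m i ^ 2 / stat_prob n i) = fringe_mean n m * stat_chi n m"
proof -
  have N: "real (stat_size n) \<noteq> 0" and M: "real (stat_size m) \<noteq> 0"
    using stat_size_pos[OF n] stat_size_pos[OF m] by auto
  have "real (stat_size m) ^ 2 * (stat_prob m i ^ 2 / stat_prob n i)
      = real (stat_size n) * ((real (m i))\<^sup>2 / real (n i))" for i
    using N M by (simp add: stat_prob_def power_divide)
  then have "real (stat_size m) ^ 2 * (\<Sum>i\<in>degrees m. stat_prob m i ^ 2 / stat_prob n i)
      = real (stat_size n) * stat_chi n m"
    by (simp add: stat_chi_def sum_distrib_left)
  then show ?thesis
    by (simp add: fringe_mean_def mult_ac)
qed

text \<open>The situation common to the Poisson and the normal regime: in both the mean stays away from \<open>0\<close>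
eventually. Then factorial moments of fixed order are covered by orders up to \<open>C sqrt \<mu>\<close>.\<close>
locale fringe_sequence =
  fixes n m :: "nat \<Rightarrow> nat \<Rightarrow> nat"
  assumes deg: "eventually (\<lambda>k. is_degree_statistic (n k) \<and> is_degree_statistic (m k)) sequentially"
    and chi: "(\<lambda>k. fringe_mean (n k) (m k) * stat_chi (n k) (m k)) \<longlonglongrightarrow> 0"
    and bounded_below: "\<exists>\<delta>>0. eventually (\<lambda>k. fringe_mean (n k) (m k) \<ge> \<delta>) sequentially"
begin

abbreviation "mu k \<equiv> fringe_mean (n k) (m k)"
abbreviation "P k \<equiv> fringe_pmf (n k) (m k)"

lemma mu_pos: "eventually (\<lambda>k. mu k > 0) sequentially"
proof -
  obtain \<delta> where "\<delta> > 0" "eventually (\<lambda>k. mu k \<ge> \<delta>) sequentially"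
    using bounded_below by blast
  from this(2) show ?thesis
    by eventually_elim (use \<open>\<delta> > 0\<close> in linarith)
qed

lemma sq_chi_tendsto:
  assumes q: "eventually (\<lambda>k. real (q k) \<le> C * sqrt (mu k)) sequentially"
  shows "(\<lambda>k. (real (q k))\<^sup>2 * stat_chi (n k) (m k)) \<longlonglongrightarrow> 0"
proof (rule Lim_null_comparison)
  show "eventually (\<lambda>k. norm ((real (q k))\<^sup>2 * stat_chi (n k) (m k))
      \<le> C\<^sup>2 * (mu k * stat_chi (n k) (m k))) sequentially"
    using q mu_pos
  proof eventually_elim
    case (elim k)
    have "(real (q k))\<^sup>2 \<le> (C * sqrt (mu k))\<^sup>2"
      using elim(1) by (intro power_mono) auto
    also have "\<dots> = C\<^sup>2 * mu k"
      using elim(2) by (simp add: power_mult_distrib)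
    finally have "(real (q k))\<^sup>2 * stat_chi (n k) (m k) \<le> C\<^sup>2 * mu k * stat_chi (n k) (m k)"
      using stat_chi_nonneg by (intro mult_right_mono) auto
    then show ?case
      using stat_chi_nonneg by (simp add: mult.assoc)
  qed
  show "(\<lambda>k. C\<^sup>2 * (mu k * stat_chi (n k) (m k))) \<longlonglongrightarrow> 0"
    using tendsto_mult_left[OF chi, of "C\<^sup>2"] by simp
qed

lemma falling_moment_ratio_tendsto:
  assumes q: "eventually (\<lambda>k. real (q k) \<le> C * sqrt (mu k)) sequentially"
  shows "(\<lambda>k. falling_moment (P k) (q k) / mu k ^ q k) \<longlonglongrightarrow> 1"
proof (rule tendsto_sandwich)
  let ?e = "\<lambda>k. (real (q k))\<^sup>2 * stat_chi (n k) (m k)"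
  have e: "?e \<longlonglongrightarrow> 0" by (rule sq_chi_tendsto[OF q])
  have ev: "eventually (\<lambda>k. ?e k < 1) sequentially"
    using e by (rule order_tendstoD) simp
  show "eventually (\<lambda>k. 1 - ?e k \<le> falling_moment (P k) (q k) / mu k ^ q k) sequentially"
    using deg mu_pos ev
    by eventually_elim (simp add: expectation_fringe_pmf expectation_falling_ratio_bounds)
  show "eventually (\<lambda>k. falling_moment (P k) (q k) / mu k ^ q k \<le> 1 / (1 - ?e k)) sequentially"
    using deg mu_pos ev
    by eventually_elim (simp add: expectation_fringe_pmf expectation_falling_ratio_bounds)
  show "(\<lambda>k. 1 - ?e k) \<longlonglongrightarrow> 1"
    using tendsto_diff[OF tendsto_const e, of 1] by simp
  show "(\<lambda>k. 1 / (1 - ?e k)) \<longlonglongrightarrow> 1"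
    using tendsto_divide[OF tendsto_const tendsto_diff[OF tendsto_const e], of 1 1] by simp
qed

lemma const_le_sqrt_mu: "\<exists>C. eventually (\<lambda>k. real q \<le> C * sqrt (mu k)) sequentially"
proof -
  obtain \<delta> where \<delta>: "\<delta> > 0" and ev: "eventually (\<lambda>k. mu k \<ge> \<delta>) sequentially"
    using bounded_below by blast
  from ev have "eventually (\<lambda>k. real q \<le> (real q / sqrt \<delta>) * sqrt (mu k)) sequentially"
  proof eventually_elim
    case (elim k)
    have "(real q / sqrt \<delta>) * sqrt \<delta> \<le> (real q / sqrt \<delta>) * sqrt (mu k)"
      using elim \<delta> by (intro mult_left_mono) auto
    then show ?case using \<delta> by simp
  qed
  then show ?thesis by blast
qed

lemma falling_moment_ratio_tendsto_const:
  "(\<lambda>k. falling_moment (P k) q / mu k ^ q) \<longlonglongrightarrow> 1"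
  using const_le_sqrt_mu[of q] falling_moment_ratio_tendsto[of "\<lambda>_. q"] by blast

text \<open>For a fixed order the relative error of the factorial moments is \<open>o(1 / \<mu>)\<close>. This rate is what allows the
leading terms \<open>\<mu>\<^sup>2\<close> to cancel in the variance.\<close>
lemma falling_moment_diff_tendsto: "(\<lambda>k. mu k * (falling_moment (P k) q / mu k ^ q - 1)) \<longlonglongrightarrow> 0"
proof (rule Lim_null_comparison)
  let ?e = "\<lambda>k. (real q)\<^sup>2 * stat_chi (n k) (m k)"
  obtain C where C: "eventually (\<lambda>k. real q \<le> C * sqrt (mu k)) sequentially"
    using const_le_sqrt_mu by blast
  have e: "?e \<longlonglongrightarrow> 0" by (rule sq_chi_tendsto[OF C])
  have ev: "eventually (\<lambda>k. ?e k < 1 / 2) sequentially"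
    using e by (rule order_tendstoD) simp
  show "eventually (\<lambda>k. norm (mu k * (falling_moment (P k) q / mu k ^ q - 1)) \<le> mu k * (2 * ?e k)) sequentially"
    using deg mu_pos ev
  proof eventually_elim
    case (elim k)
    let ?R = "falling_moment (P k) q / mu k ^ q"
    have e0: "?e k \<ge> 0" using stat_chi_nonneg by simp
    have "1 - ?e k \<le> ?R" "?R \<le> 1 / (1 - ?e k)"
      using elim by (simp_all add: expectation_fringe_pmf expectation_falling_ratio_bounds)
    moreover have "1 / (1 - ?e k) \<le> 1 + 2 * ?e k"
    proof -
      have "?e k * (2 * ?e k) \<le> ?e k * 1"
        using elim(3) e0 by (intro mult_left_mono) auto
      then have "1 \<le> (1 + 2 * ?e k) * (1 - ?e k)" by (simp add: algebra_simps)
      then show ?thesis using elim(3) by (simp add: pos_divide_le_eq)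
    qed
    ultimately have "\<bar>?R - 1\<bar> \<le> 2 * ?e k"
      using e0 unfolding abs_le_iff by linarith
    then show ?case
      using elim(2) by (simp add: abs_mult)
  qed
  show "(\<lambda>k. mu k * (2 * ?e k)) \<longlonglongrightarrow> 0"
    using tendsto_mult_left[OF chi, of "2 * (real q)\<^sup>2"] by (simp add: mult_ac)
qed

lemma mean_diff_tendsto: "(\<lambda>k. measure_pmf.expectation (P k) real - mu k) \<longlonglongrightarrow> 0"
proof -
  have "eventually (\<lambda>k. mu k * (falling_moment (P k) 1 / mu k ^ 1 - 1)
      = measure_pmf.expectation (P k) real - mu k) sequentially"
    using mu_pos by eventually_elim (simp add: falling_def field_simps)
  with falling_moment_diff_tendsto[of 1] show ?thesis
    by (rule Lim_transform_eventually)
qed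

lemma mean_ratio_tendsto: "(\<lambda>k. measure_pmf.expectation (P k) real / mu k) \<longlonglongrightarrow> 1"
  using falling_moment_ratio_tendsto_const[of 1] by (simp add: falling_def)

text \<open>With \<open>R q\<close> for the normalized factorial moment of order \<open>q\<close>, the variance divided by \<open>\<mu>\<close> is
\<open>\<mu> (R 2 - (R 1)\<^sup>2) + R 1\<close>.\<close>
lemma variance_ratio_tendsto: "(\<lambda>k. measure_pmf.variance (P k) real / mu k) \<longlonglongrightarrow> 1"
proof -
  let ?R = "\<lambda>q k. falling_moment (P k) q / mu k ^ q"
  have eq: "eventually (\<lambda>k. mu k * (?R 2 k - 1) - mu k * (?R 1 k - 1) * (?R 1 k + 1) + ?R 1 k
      = measure_pmf.variance (P k) real / mu k) sequentially"
    using deg mu_pos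
  proof eventually_elim
    case (elim k)
    have int: "integrable (measure_pmf (P k)) f" for f :: "nat \<Rightarrow> real"
      using elim by (intro integrable_measure_pmf_finite finite_set_fringe_pmf) auto
    have "(real x)\<^sup>2 = falling (real x) 2 + falling (real x) 1" for x
      by (simp add: falling_def numeral_2_eq_2 power2_eq_square algebra_simps)
    then have var: "measure_pmf.variance (P k) real
        = falling_moment (P k) 2 + falling_moment (P k) 1 - (falling_moment (P k) 1)\<^sup>2"
      using int by (subst measure_pmf.variance_eq) (simp_all add: falling_def)
    show ?case
      unfolding var using elim(2) by (simp add: field_simps power2_eq_square)
  qed
  have "(\<lambda>k. mu k * (?R 2 k - 1) - mu k * (?R 1 k - 1) * (?R 1 k + 1) + ?R 1 k) \<longlonglongrightarrow> 0 - 0 * (1 + 1) + 1"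
    by (intro tendsto_intros falling_moment_diff_tendsto falling_moment_ratio_tendsto_const)
  then show ?thesis
    using Lim_transform_eventually[OF _ eq] by simp
qed

lemma variance_equiv: "(\<lambda>k. measure_pmf.variance (P k) real) \<sim>[sequentially] mu"
  by (rule asymp_equivI'[OF variance_ratio_tendsto])

lemma mean_equiv_variance:
  "(\<lambda>k. measure_pmf.expectation (P k) real) \<sim>[sequentially] (\<lambda>k. measure_pmf.variance (P k) real)"
  by (rule asymp_equiv_trans[OF asymp_equivI'[OF mean_ratio_tendsto] asymp_equiv_symI[OF variance_equiv]])

lemma poisson_case:
  assumes lam: "lam > 0" and mu: "mu \<longlonglongrightarrow> lam"
  shows "weak_conv_m (\<lambda>k. distr (measure_pmf (P k)) borel real) (distr (poisson_pmf lam) borel real)"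
    and "(\<lambda>k. measure_pmf.expectation (P k) (\<lambda>x. real x ^ r)) \<longlonglongrightarrow>
      measure_pmf.expectation (poisson_pmf lam) (\<lambda>x. real x ^ r)"
proof -
  have fm: "(\<lambda>k. falling_moment (P k) q) \<longlonglongrightarrow> lam ^ q" for q
  proof -
    have "(\<lambda>k. falling_moment (P k) q / mu k ^ q * mu k ^ q) \<longlonglongrightarrow> 1 * lam ^ q"
      by (intro tendsto_intros falling_moment_ratio_tendsto_const mu)
    moreover have "eventually (\<lambda>k. falling_moment (P k) q / mu k ^ q * mu k ^ q = falling_moment (P k) q) sequentially"
      using mu_pos by eventually_elim simp
    ultimately have "(\<lambda>k. falling_moment (P k) q) \<longlonglongrightarrow> 1 * lam ^ q"
      by (rule Lim_transform_eventually)
    then show ?thesis by simp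
  qed
  have ev: "eventually (\<lambda>k. has_falling_moments (P k)) sequentially"
    using deg by eventually_elim (simp add: has_falling_moments_if_finite finite_set_fringe_pmf)
  show "weak_conv_m (\<lambda>k. distr (measure_pmf (P k)) borel real) (distr (poisson_pmf lam) borel real)"
    by (rule poisson_limit(1)[OF lam ev fm])
  show "(\<lambda>k. measure_pmf.expectation (P k) (\<lambda>x. real x ^ r)) \<longlonglongrightarrow>
      measure_pmf.expectation (poisson_pmf lam) (\<lambda>x. real x ^ r)"
    by (rule poisson_limit(2)[OF lam ev fm])
qed

definition standardized :: "nat \<Rightarrow> nat \<Rightarrow> real" where
  "standardized k x = (real x - mu k) / sqrt (mu k)"

lemma standardized_mean_variance:
  assumes good: "is_degree_statistic (n k)" and "mu k > 0"
  shows "measure_pmf.expectation (P k) (standardized k) = (measure_pmf.expectation (P k) real - mu k) / sqrt (mu k)"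
    and "measure_pmf.variance (P k) (standardized k) = measure_pmf.variance (P k) real / mu k"
    and "measure_pmf.expectation (P k) (\<lambda>x. (standardized k x)\<^sup>2)
      = measure_pmf.variance (P k) (standardized k) + (measure_pmf.expectation (P k) (standardized k))\<^sup>2"
proof -
  have int: "integrable (measure_pmf (P k)) f" for f :: "nat \<Rightarrow> real"
    using good by (intro integrable_measure_pmf_finite finite_set_fringe_pmf)
  show E: "measure_pmf.expectation (P k) (standardized k) = (measure_pmf.expectation (P k) real - mu k) / sqrt (mu k)"
    using int by (simp add: standardized_def[abs_def])
  have "(standardized k x - measure_pmf.expectation (P k) (standardized k))\<^sup>2 = (real x - measure_pmf.expectation (P k) real)\<^sup>2 / mu k" for x
    unfolding E standardized_def diff_divide_distrib[symmetric] using assms(2) by (simp add: power_divide)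
  then show "measure_pmf.variance (P k) (standardized k) = measure_pmf.variance (P k) real / mu k"
    by simp
  show "measure_pmf.expectation (P k) (\<lambda>x. (standardized k x)\<^sup>2)
      = measure_pmf.variance (P k) (standardized k) + (measure_pmf.expectation (P k) (standardized k))\<^sup>2"
    using int by (subst measure_pmf.variance_eq) auto
qed

lemma standardized_mean_tendsto: "(\<lambda>k. measure_pmf.expectation (P k) (standardized k)) \<longlonglongrightarrow> 0"
proof -
  obtain \<delta> where \<delta>: "\<delta> > 0" and ev: "eventually (\<lambda>k. mu k \<ge> \<delta>) sequentially"
    using bounded_below by blast
  have "eventually (\<lambda>k. norm (measure_pmf.expectation (P k) (standardized k))
      \<le> \<bar>measure_pmf.expectation (P k) real - mu k\<bar> / sqrt \<delta>) sequentially"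
    using deg ev
  proof eventually_elim
    case (elim k)
    then show ?case
      using \<delta> standardized_mean_variance(1)[of k] by (simp add: abs_divide frac_le)
  qed
  moreover have "(\<lambda>k. \<bar>measure_pmf.expectation (P k) real - mu k\<bar> / sqrt \<delta>) \<longlonglongrightarrow> 0"
    using tendsto_divide[OF tendsto_rabs[OF mean_diff_tendsto] tendsto_const, of "sqrt \<delta>"] \<delta> by simp
  ultimately show ?thesis
    by (rule Lim_null_comparison)
qed

lemma standardized_variance_tendsto: "(\<lambda>k. measure_pmf.variance (P k) (standardized k)) \<longlonglongrightarrow> 1"
proof (rule Lim_transform_eventually[OF variance_ratio_tendsto])
  show "eventually (\<lambda>k. measure_pmf.variance (P k) real / mu k = measure_pmf.variance (P k) (standardized k)) sequentially"
    using deg mu_pos by eventually_elim (simp only: standardized_mean_variance(2))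
qed

end

lemma weak_conv_m_offset:
  assumes "weak_conv_m (\<lambda>k. L (k + j)) M"
  shows "weak_conv_m L M"
  unfolding weak_conv_m_def weak_conv_def
proof (intro allI impI)
  fix x assume "isCont (cdf M) x"
  with assms have "(\<lambda>k. cdf (L (k + j)) x) \<longlonglongrightarrow> cdf M x"
    by (simp add: weak_conv_m_def weak_conv_def)
  then show "(\<lambda>k. cdf (L k) x) \<longlonglongrightarrow> cdf M x"
    by (rule LIMSEQ_offset)
qed

text \<open>The bounds that \<open>normal_limit\<close> requires for every index hold from some index \<open>k0\<close> on, so it is
applied to the shifted sequence.\<close>
lemma (in fringe_sequence) normal_case:
  assumes mu: "filterlim mu at_top sequentially"
  shows "weak_conv_m (\<lambda>k. distr (measure_pmf (P k)) borel (standardized k)) std_normal_distribution"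
proof -
  have "(\<lambda>k. measure_pmf.variance (P k) (standardized k) + (measure_pmf.expectation (P k) (standardized k))\<^sup>2) \<longlonglongrightarrow> 1 + 0\<^sup>2"
    by (rule tendsto_add[OF standardized_variance_tendsto tendsto_power[OF standardized_mean_tendsto]])
  then have "eventually (\<lambda>k. measure_pmf.variance (P k) (standardized k) + (measure_pmf.expectation (P k) (standardized k))\<^sup>2 < 2) sequentially"
    by (rule order_tendstoD) simp
  with deg mu_pos have "eventually (\<lambda>k. is_degree_statistic (n k) \<and> mu k > 0 \<and>
      measure_pmf.expectation (P k) (\<lambda>x. (standardized k x)\<^sup>2) \<le> 2) sequentially"
    by eventually_elim (simp only: standardized_mean_variance(3), simp)
  then obtain k0 where k0: "\<And>k. k \<ge> k0 \<Longrightarrow> is_degree_statistic (n k) \<and> mu k > 0 \<and>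
      measure_pmf.expectation (P k) (\<lambda>x. (standardized k x)\<^sup>2) \<le> 2"
    unfolding eventually_sequentially by blast
  interpret shifted: fringe_sequence "\<lambda>k. n (k + k0)" "\<lambda>k. m (k + k0)"
  proof
    show "eventually (\<lambda>k. is_degree_statistic (n (k + k0)) \<and> is_degree_statistic (m (k + k0))) sequentially"
      by (rule sequentially_offset[OF deg, of k0])
    show "(\<lambda>k. mu (k + k0) * stat_chi (n (k + k0)) (m (k + k0))) \<longlonglongrightarrow> 0"
      by (rule LIMSEQ_ignore_initial_segment[OF chi, of k0])
    show "\<exists>\<delta>>0. eventually (\<lambda>k. \<delta> \<le> mu (k + k0)) sequentially"
    proof -
      obtain \<delta> where "\<delta> > 0" "eventually (\<lambda>k. \<delta> \<le> mu k) sequentially"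
        using bounded_below by blast
      from this(1) sequentially_offset[OF this(2), of k0] show ?thesis by (intro exI[of _ \<delta>] conjI)
    qed
  qed
  have "weak_conv_m (\<lambda>k. distr (measure_pmf (P (k + k0))) borel (standardized (k + k0)))
      std_normal_distribution"
    unfolding standardized_def[abs_def]
  proof (rule normal_limit[where P = "\<lambda>k. P (k + k0)" and \<mu> = "\<lambda>k. mu (k + k0)" and B = 2])
    fix k
    from k0[of "k + k0"] have good: "is_degree_statistic (n (k + k0))" "mu (k + k0) > 0"
      "measure_pmf.expectation (P (k + k0)) (\<lambda>x. (standardized (k + k0) x)\<^sup>2) \<le> 2"
      by auto
    show "finite (set_pmf (P (k + k0)))"
      by (rule finite_set_fringe_pmf[OF good(1)])
    show "mu (k + k0) > 0" by (rule good(2))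
    show "measure_pmf.expectation (P (k + k0)) (\<lambda>x. ((real x - mu (k + k0)) / sqrt (mu (k + k0)))\<^sup>2) \<le> 2"
      using good(3) unfolding standardized_def .
  next
    show "filterlim (\<lambda>k. mu (k + k0)) at_top sequentially"
      by (rule filterlim_compose[OF mu filterlim_add_const_nat_at_top])
  next
    fix q C assume "\<And>k. real (q k) \<le> C * sqrt (mu (k + k0))"
    then show "(\<lambda>k. falling_moment (P (k + k0)) (q k) / mu (k + k0) ^ q k) \<longlonglongrightarrow> 1"
      by (intro shifted.falling_moment_ratio_tendsto[of q C] always_eventually allI)
  qed
  then show ?thesis
    by (rule weak_conv_m_offset)
qed

theorem theorem4p2:
  fixes n m :: "nat \<Rightarrow> nat \<Rightarrow> nat" and p :: "nat pmf"
  assumes "\<And>\<kappa>. \<kappa> \<ge> 1 \<Longrightarrow> is_degree_statistic (n \<kappa>)"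
    and "\<And>\<kappa>. \<kappa> \<ge> 1 \<Longrightarrow> is_degree_statistic (m \<kappa>)"
    and "filterlim (\<lambda>\<kappa>. stat_size (n \<kappa>)) at_top sequentially"
    and "\<And>i. (\<lambda>\<kappa>. stat_prob (n \<kappa>) i) \<longlonglongrightarrow> pmf p i"
    and "(\<lambda>\<kappa>. real (stat_size (m \<kappa>)) ^ 2 * trees_weight (stat_prob (n \<kappa>)) (m \<kappa>) *
            (\<Sum>i\<in>degrees (m \<kappa>). stat_prob (m \<kappa>) i ^ 2 / stat_prob (n \<kappa>) i)) \<longlonglongrightarrow> 0"
  defines "\<mu> \<equiv> \<lambda>\<kappa>. real (stat_size (n \<kappa>)) * trees_weight (stat_prob (n \<kappa>)) (m \<kappa>)"
    and "N \<equiv> \<lambda>\<kappa> T. real (fringe_count (m \<kappa>) T)"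
    and "Z \<equiv> \<lambda>\<kappa> T. (real (fringe_count (m \<kappa>) T)
                 - real (stat_size (n \<kappa>)) * trees_weight (stat_prob (n \<kappa>)) (m \<kappa>))
               / sqrt (real (stat_size (n \<kappa>)) * trees_weight (stat_prob (n \<kappa>)) (m \<kappa>))"
  shows
   "(\<forall>lam>0. \<mu> \<longlonglongrightarrow> lam \<longrightarrow>
       weak_conv_m (\<lambda>\<kappa>. distr (random_tree (n \<kappa>)) borel (N \<kappa>)) (distr (poisson_pmf lam) borel real)
       \<and> (\<forall>r::nat. (\<lambda>\<kappa>. measure_pmf.expectation (random_tree (n \<kappa>)) (\<lambda>T. N \<kappa> T ^ r))
              \<longlonglongrightarrow> measure_pmf.expectation (poisson_pmf lam) (\<lambda>x. real x ^ r)))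
    \<and> (filterlim \<mu> at_top sequentially \<longrightarrow>
       weak_conv_m (\<lambda>\<kappa>. distr (random_tree (n \<kappa>)) borel (Z \<kappa>)) std_normal_distribution
       \<and> (\<lambda>\<kappa>. measure_pmf.expectation (random_tree (n \<kappa>)) (Z \<kappa>)) \<longlonglongrightarrow> 0
       \<and> (\<lambda>\<kappa>. measure_pmf.variance (random_tree (n \<kappa>)) (Z \<kappa>)) \<longlonglongrightarrow> 1)
    \<and> (((\<exists>lam>0. \<mu> \<longlonglongrightarrow> lam) \<or> filterlim \<mu> at_top sequentially) \<longrightarrow>
       (\<lambda>\<kappa>. measure_pmf.expectation (random_tree (n \<kappa>)) (N \<kappa>)) \<sim>[sequentially]
         (\<lambda>\<kappa>. measure_pmf.variance (random_tree (n \<kappa>)) (N \<kappa>))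
       \<and> (\<lambda>\<kappa>. measure_pmf.variance (random_tree (n \<kappa>)) (N \<kappa>)) \<sim>[sequentially] \<mu>)"
proof -
  have mu_eq: "\<mu> = (\<lambda>k. fringe_mean (n k) (m k))"
    by (simp add: \<mu>_def fringe_mean_def)
  have seq: "fringe_sequence n m"
    if below: "\<exists>\<delta>>0. eventually (\<lambda>k. \<mu> k \<ge> \<delta>) sequentially"
  proof
    show deg: "eventually (\<lambda>k. is_degree_statistic (n k) \<and> is_degree_statistic (m k)) sequentially"
      using assms(1,2) unfolding eventually_sequentially by blast
    show "(\<lambda>k. fringe_mean (n k) (m k) * stat_chi (n k) (m k)) \<longlonglongrightarrow> 0"
      using assms(5) by (rule Lim_transform_eventually)
        (use deg in \<open>eventually_elim, simp only: fringe_mean_stat_chi_eq\<close>)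
    show "\<exists>\<delta>>0. eventually (\<lambda>k. fringe_mean (n k) (m k) \<ge> \<delta>) sequentially"
      using below by (simp add: mu_eq)
  qed
  have seq_finite: "fringe_sequence n m" if "lam > 0" "\<mu> \<longlonglongrightarrow> lam" for lam
  proof (rule seq, intro exI conjI)
    show "lam / 2 > 0" using \<open>lam > 0\<close> by simp
    have "eventually (\<lambda>k. lam / 2 < \<mu> k) sequentially"
      using \<open>\<mu> \<longlonglongrightarrow> lam\<close> by (rule order_tendstoD) (use \<open>lam > 0\<close> in simp)
    then show "eventually (\<lambda>k. lam / 2 \<le> \<mu> k) sequentially"
      by eventually_elim simp
  qed
  have seq_infinite: "fringe_sequence n m" if "filterlim \<mu> at_top sequentially"
    using that by (intro seq exI[of _ 1]) (simp add: filterlim_at_top)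
  have Z_eq: "Z k = (\<lambda>T. fringe_sequence.standardized n m k (fringe_count (m k) T))" if "fringe_sequence n m" for k
    using that by (simp add: Z_def fringe_sequence.standardized_def fringe_mean_def)
  show ?thesis
  proof (intro conjI allI impI)
    fix lam :: real and r :: nat assume lam: "lam > 0" "\<mu> \<longlonglongrightarrow> lam"
    interpret fringe_sequence n m by (rule seq_finite[OF lam])
    show "weak_conv_m (\<lambda>\<kappa>. distr (random_tree (n \<kappa>)) borel (N \<kappa>)) (distr (poisson_pmf lam) borel real)"
      using poisson_case(1)[of lam] lam by (simp add: distr_fringe_pmf N_def mu_eq)
    show "(\<lambda>\<kappa>. measure_pmf.expectation (random_tree (n \<kappa>)) (\<lambda>T. N \<kappa> T ^ r))
        \<longlonglongrightarrow> measure_pmf.expectation (poisson_pmf lam) (\<lambda>x. real x ^ r)"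
      using poisson_case(2)[of lam r] lam by (simp add: expectation_fringe_pmf N_def mu_eq)
  next
    assume inf: "filterlim \<mu> at_top sequentially"
    interpret fringe_sequence n m by (rule seq_infinite[OF inf])
    note Z = Z_eq[OF fringe_sequence_axioms]
    show "weak_conv_m (\<lambda>\<kappa>. distr (random_tree (n \<kappa>)) borel (Z \<kappa>)) std_normal_distribution"
      using normal_case inf by (simp add: distr_fringe_pmf Z mu_eq)
    show "(\<lambda>\<kappa>. measure_pmf.expectation (random_tree (n \<kappa>)) (Z \<kappa>)) \<longlonglongrightarrow> 0"
      using standardized_mean_tendsto by (simp add: expectation_fringe_pmf Z)
    show "(\<lambda>\<kappa>. measure_pmf.variance (random_tree (n \<kappa>)) (Z \<kappa>)) \<longlonglongrightarrow> 1"
      using standardized_variance_tendsto by (simp add: expectation_fringe_pmf Z)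
  next
    assume "(\<exists>lam>0. \<mu> \<longlonglongrightarrow> lam) \<or> filterlim \<mu> at_top sequentially"
    then interpret fringe_sequence n m
      using seq_finite seq_infinite by blast
    show "(\<lambda>\<kappa>. measure_pmf.expectation (random_tree (n \<kappa>)) (N \<kappa>)) \<sim>[sequentially]
        (\<lambda>\<kappa>. measure_pmf.variance (random_tree (n \<kappa>)) (N \<kappa>))"
      using mean_equiv_variance by (simp add: expectation_fringe_pmf N_def)
    show "(\<lambda>\<kappa>. measure_pmf.variance (random_tree (n \<kappa>)) (N \<kappa>)) \<sim>[sequentially] \<mu>"
      using variance_equiv by (simp add: expectation_fringe_pmf N_def mu_eq)
  qed
qed

end
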